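(* Let $p,q$ be distinct odd primes and $\alpha,\beta$ positive integers. Then $$\sum_{\substack{i+j+k=p^{\alpha}q^{\beta}\\ i,j,k\in\mathcal{P}_{pq}}}\frac{(-1)^{i}}{ijk}\equiv-\frac{1}{4}Z(p^{\alpha}q^{\beta})\equiv \frac{1}{2}(q-2)\Bigl(1-\frac{1}{q^{3}}\Bigr)p^{\alpha-1}q^{\beta-1}B_{p-3}\pmod{p^{\alpha}}.$$
   Context: For a positive integer $n$, $\mathcal{P}_n$ denotes the set of positive integers coprime to $n$, and $Z(n)=\sum_{i+j+k=n,\ i,j,k\in\mathcal{P}_n}\frac{1}{ijk}$. All sums are over ordered triples $(i,j,k)$ of positive integers. The Bernoulli numbers $B_k$ are defined by $B_0=1$ and $\sum_{i=0}^{n}\binom{n+1}{i}B_i=0$ for $n\ge1$. A congruence between rational numbers modulo $p^{\alpha}$ means that the difference, written in lowest terms, has numerator divisible by $p^{\alpha}$ and denominator coprime to $p$. *)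

theory Defs
  imports "HOL-Number_Theory.Number_Theory"
begin

definition coprime_pos :: "nat \<Rightarrow> nat set" where
  "coprime_pos n = {i. 0 < i \<and> coprime i n}"

text \<open>Ordered triples of elements of \<open>coprime_pos m\<close> with sum \<open>n\<close>.\<close>

definition sum_triples :: "nat \<Rightarrow> nat \<Rightarrow> (nat \<times> nat \<times> nat) set" where
  "sum_triples n m = {(i, j, k). i + j + k = n \<and>
     i \<in> coprime_pos m \<and> j \<in> coprime_pos m \<and> k \<in> coprime_pos m}"

lemma finite_sum_triples [simp]: "finite (sum_triples n m)"
  by (rule finite_subset [of _ "{..n} \<times> {..n} \<times> {..n}"]) (auto simp: sum_triples_def)

definition Z :: "nat \<Rightarrow> rat" where
  "Z n = (\<Sum>(i, j, k)\<in>sum_triples n n. 1 / (of_nat i * of_nat j * of_nat k))"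

fun bernoulli :: "nat \<Rightarrow> rat" where
  "bernoulli 0 = 1"
| "bernoulli (Suc n) =
     - (\<Sum>i\<le>n. of_nat (Suc (Suc n) choose i) * bernoulli i) / of_nat (Suc (Suc n))"

text \<open>The recursion above is the following identity solved for its last term.\<close>

lemma bernoulli_recurrence:
  assumes "n \<ge> 1"
  shows "(\<Sum>i=0..n. of_nat ((n + 1) choose i) * bernoulli i) = 0"
proof -
  obtain m where n: "n = Suc m"
    using assms by (cases n) auto
  have "of_nat (Suc (Suc m)) \<noteq> (0 :: rat)"
    by (rule of_nat_neq_0)
  moreover have "Suc (Suc m) choose Suc m = Suc (Suc m)"
    using binomial_symmetric [of "Suc m" "Suc (Suc m)"] by simp
  ultimately show ?thesis
    unfolding n by (simp add: atMost_atLeast0 del: of_nat_Suc binomial_Suc_Suc)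
qed

text \<open>Congruence of rationals modulo \<open>p ^ a\<close>. The base \<open>p\<close> is a separate argument because the
  denominator has to be coprime to \<open>p\<close> itself; \<open>quotient_of\<close> returns lowest terms.\<close>

definition rat_cong :: "nat \<Rightarrow> nat \<Rightarrow> rat \<Rightarrow> rat \<Rightarrow> bool" where
  "rat_cong p a x y \<longleftrightarrow>
     int p ^ a dvd fst (quotient_of (x - y)) \<and> coprime (snd (quotient_of (x - y))) (int p)"

end

theory Submission
  imports Defs
begin

text \<open>Let \<open>S(n)\<close> be the sum of \<open>1/(ijk)\<close> over the triples with sum \<open>n\<close> coprime to \<open>pq\<close>.
  Writing \<open>i = i' + a M\<close> with \<open>i' < M\<close>, expanding to first order in \<open>M\<close>, and using the reflection
  \<open>i' \<mapsto> M - i'\<close> shows that \<open>S(mM) \<equiv> m S(M)\<close> modulo \<open>p\<^sup>a\<close> if \<open>p\<^sup>a\<close> divides \<open>M\<close>, and even modulo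
  \<open>p\<^sup>a\<^sup>+\<^sup>1\<close> if moreover \<open>p\<close> divides \<open>m\<close>. This reduces the second congruence to \<open>S(pq)\<close> modulo \<open>p\<close>,
  where inclusion-exclusion over the multiples of \<open>q\<close>, Faulhaber's formula and Voronoi's
  congruence give the value. For the first congruence, let \<open>X\<^sub>0\<close> and \<open>X\<^sub>1\<close> be the parts of \<open>S(N)\<close>
  with all entries odd and with only \<open>i\<close> odd, so that \<open>S(N) = X\<^sub>0 + 3X\<^sub>1\<close> while the alternating sum
  is \<open>X\<^sub>1 - X\<^sub>0\<close>. Reducing the all-even triples of sum \<open>2N\<close> modulo \<open>N\<close> gives
  \<open>S(N)/8 \<equiv> 3X\<^sub>1 - X\<^sub>0\<close>, hence \<open>3X\<^sub>0 \<equiv> 7X\<^sub>1\<close>.\<close>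

section \<open>Congruences of rationals modulo powers of an odd prime\<close>

locale odd_prime =
  fixes p :: nat
  assumes prime_p: "prime p" and odd_p: "odd p"
begin

text \<open>The ideal generated by \<open>p\<^sup>a\<close> in the ring of \<open>p\<close>-integral rationals, which is \<open>pideal 0\<close>.\<close>

definition pideal :: "nat \<Rightarrow> rat set" where
  "pideal a = {of_nat p ^ a * of_int u / of_int v | u v. \<not> int p dvd v}"

lemma p_gt_0: "p > 0" and p_gt_2: "p > 2"
  using prime_p odd_p prime_gt_0_nat prime_ge_2_nat[of p] by (auto simp: order_less_le)

lemma prime_int_p: "prime (int p)"
  using prime_p by simp

lemma pidealE:
  assumes "x \<in> pideal a"
  obtains u v where "x = of_nat p ^ a * of_int u / of_int v" "\<not> int p dvd v" "v \<noteq> 0"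
  using assms unfolding pideal_def by force

lemma pidealI: "x = of_nat p ^ a * of_int u / of_int v \<Longrightarrow> \<not> int p dvd v \<Longrightarrow> x \<in> pideal a"
  unfolding pideal_def by blast

text \<open>Passes from the lowest-terms definition to arbitrary fractions whose denominator is
  prime to \<open>p\<close>. These form an ideal, so congruences can be handled by closure
  properties.\<close>

lemma rat_cong_iff: "rat_cong p a x y \<longleftrightarrow> x - y \<in> pideal a"
proof
  obtain n d where nd: "quotient_of (x - y) = (n, d)"
    by (cases "quotient_of (x - y)")
  then have xy: "x - y = of_int n / of_int d" and d: "d > 0" and cop: "coprime n d"
    by (auto intro: quotient_of_div quotient_of_denom_pos quotient_of_coprime)
  {
    assume "rat_cong p a x y"
    then have "int p ^ a dvd n" "coprime d (int p)"
      by (auto simp: rat_cong_def nd)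
    then obtain u where u: "n = int p ^ a * u"
      by auto
    have "\<not> int p dvd d"
      using \<open>coprime d (int p)\<close> prime_int_p by (metis coprime_absorb_right not_prime_unit)
    then show "x - y \<in> pideal a"
      by (intro pidealI[of _ _ u d]) (auto simp: xy u)
  }
  {
    assume "x - y \<in> pideal a"
    then obtain u v where uv: "x - y = of_nat p ^ a * of_int u / of_int v"
      and v: "\<not> int p dvd v" "v \<noteq> 0"
      by (rule pidealE)
    have "of_int (n * v) = (of_int (int p ^ a * u * d) :: rat)"
      using uv xy v d by (simp add: field_simps)
    then have eq: "n * v = int p ^ a * u * d"
      by (simp only: of_int_eq_iff)
    have cv: "coprime (int p) v"
      using v prime_int_p by (simp add: prime_imp_coprime)
    have "int p ^ a dvd n * v"
      by (simp add: eq)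
    then have "int p ^ a dvd n"
      using cv by (simp add: coprime_dvd_mult_left_iff)
    \<comment> \<open>Lowest terms make \<open>d\<close> divide \<open>v\<close>, so
      \<open>d\<close> inherits coprimality to \<open>p\<close>.\<close>
    moreover have "d dvd v * n"
      by (simp add: eq mult.commute[of v])
    then have "d dvd v"
      using cop by (simp add: coprime_dvd_mult_left_iff coprime_commute)
    then have "coprime d (int p)"
      using cv coprime_divisors[of d v "int p" "int p"] by (simp add: coprime_commute)
    ultimately show "rat_cong p a x y"
      by (simp add: rat_cong_def nd)
  }
qed

lemma pideal_0 [simp]: "0 \<in> pideal a"
  by (rule pidealI[of _ _ 0 1]) (use prime_p in auto)

lemma pideal_mult:
  assumes "x \<in> pideal a" "y \<in> pideal b"
  shows "x * y \<in> pideal (a + b)"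
proof -
  obtain u v where 1: "x = of_nat p ^ a * of_int u / of_int v" "\<not> int p dvd v"
    using assms(1) by (rule pidealE)
  obtain u' v' where 2: "y = of_nat p ^ b * of_int u' / of_int v'" "\<not> int p dvd v'"
    using assms(2) by (rule pidealE)
  show ?thesis
    by (rule pidealI[of _ _ "u * u'" "v * v'"])
      (use 1 2 prime_int_p in \<open>auto simp: power_add prime_dvd_mult_iff\<close>)
qed

lemma pideal_add:
  assumes "x \<in> pideal a" "y \<in> pideal a"
  shows "x + y \<in> pideal a"
proof -
  obtain u v where 1: "x = of_nat p ^ a * of_int u / of_int v" "\<not> int p dvd v" "v \<noteq> 0"
    using assms(1) by (rule pidealE)
  obtain u' v' where 2: "y = of_nat p ^ a * of_int u' / of_int v'" "\<not> int p dvd v'" "v' \<noteq> 0"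
    using assms(2) by (rule pidealE)
  show ?thesis
    by (rule pidealI[of _ _ "u * v' + u' * v" "v * v'"])
      (use 1 2 prime_int_p in \<open>auto simp: prime_dvd_mult_iff field_simps\<close>)
qed

lemma pideal_of_int: "int p ^ a dvd n \<Longrightarrow> of_int n \<in> pideal a"
  using prime_p by (auto intro!: pidealI[of _ _ "n div int p ^ a" 1])

lemma pideal_of_nat: "p ^ a dvd n \<Longrightarrow> of_nat n \<in> pideal a"
  using pideal_of_int[of a "int n"] by (metis int_dvd_int_iff of_int_of_nat_eq of_nat_power)

lemma pideal_of_nat_power: "of_nat p ^ a \<in> pideal a"
  using pideal_of_nat[of a "p ^ a"] by simp

lemma pideal_0_of_int [simp]: "of_int n \<in> pideal 0"
  and pideal_0_of_nat [simp]: "of_nat m \<in> pideal 0"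
  and pideal_0_numeral [simp]: "numeral w \<in> pideal 0"
  and pideal_0_1 [simp]: "1 \<in> pideal 0"
  using pideal_of_int[of 0 n] pideal_of_nat[of 0 m] pideal_of_nat[of 0 "numeral w"]
    pideal_of_nat[of 0 1] by auto

lemma pideal_mult0: "x \<in> pideal 0 \<Longrightarrow> y \<in> pideal a \<Longrightarrow> x * y \<in> pideal a"
  and pideal_mult0': "x \<in> pideal a \<Longrightarrow> y \<in> pideal 0 \<Longrightarrow> x * y \<in> pideal a"
  using pideal_mult[of x 0 y a] pideal_mult[of x a y 0] by simp_all

lemma pideal_minus: "x \<in> pideal a \<Longrightarrow> - x \<in> pideal a"
  using pideal_mult0[OF pideal_0_of_int[of "- 1"]] by simp

lemma pideal_diff: "x \<in> pideal a \<Longrightarrow> y \<in> pideal a \<Longrightarrow> x - y \<in> pideal a"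
  using pideal_add[of x a "- y"] pideal_minus[of y a] by simp

lemma pideal_sum: "(\<And>i. i \<in> A \<Longrightarrow> f i \<in> pideal a) \<Longrightarrow> sum f A \<in> pideal a"
  by (induction A rule: infinite_finite_induct) (auto intro: pideal_add)

lemma pideal_power0: "x \<in> pideal 0 \<Longrightarrow> x ^ n \<in> pideal 0"
  by (induction n) (auto intro: pideal_mult0)

lemma pideal_mono:
  assumes "x \<in> pideal b" "a \<le> b"
  shows "x \<in> pideal a"
proof -
  obtain u v where 1: "x = of_nat p ^ b * of_int u / of_int v" "\<not> int p dvd v"
    using assms(1) by (rule pidealE)
  show ?thesis
    by (rule pidealI[of _ _ "int p ^ (b - a) * u" v])
      (use 1 assms(2) in \<open>auto simp flip: power_add mult.assoc\<close>)
qed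

lemma pideal_inverse_of_nat: "\<not> p dvd n \<Longrightarrow> inverse (of_nat n) \<in> pideal 0"
  by (rule pidealI[of _ _ 1 "int n"]) (auto simp: field_simps)

lemma pideal_divide_of_nat:
  assumes "x \<in> pideal a" "\<not> p dvd n"
  shows "x / of_nat n \<in> pideal a"
  using pideal_mult0'[OF assms(1) pideal_inverse_of_nat[OF assms(2)]] by (simp add: divide_inverse)

lemma pideal_cancel:
  assumes "of_nat n * x \<in> pideal a" "\<not> p dvd n"
  shows "x \<in> pideal a"
  using pideal_divide_of_nat[OF assms] assms(2) by (cases "n = 0") auto

text \<open>Dividing by \<open>p ^ b\<close> costs \<open>b\<close> powers in the modulus. It serves
  to cancel the factor 3 when \<open>p = 3\<close>, and to pass from modulus \<open>p ^ 2\<close> to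
  \<open>p\<close> in Voronoi's congruence.\<close>

lemma pideal_cancel_power:
  assumes "of_nat p ^ b * x \<in> pideal (a + b)"
  shows "x \<in> pideal a"
proof -
  obtain u v where 1: "of_nat p ^ b * x = of_nat p ^ (a + b) * of_int u / of_int v" "\<not> int p dvd v"
    using assms(1) by (rule pidealE)
  then have "of_nat p ^ b * x = of_nat p ^ b * (of_nat p ^ a * of_int u / of_int v)"
    by (simp add: power_add mult_ac)
  then have "x = of_nat p ^ a * of_int u / of_int v"
    using p_gt_0 by (subst (asm) mult_cancel_left) auto
  then show ?thesis
    using 1(2) by (rule pidealI)
qed

lemma rat_cong_refl [simp]: "rat_cong p a x x"
  by (simp add: rat_cong_iff)

lemma rat_cong_sym: "rat_cong p a x y \<Longrightarrow> rat_cong p a y x"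
  using pideal_minus[of "x - y" a] by (simp add: rat_cong_iff)

lemma rat_cong_trans [trans]: "rat_cong p a x y \<Longrightarrow> rat_cong p a y z \<Longrightarrow> rat_cong p a x z"
  using pideal_add[of "x - y" a "y - z"] by (simp add: rat_cong_iff)

lemma rat_cong_mono: "rat_cong p b x y \<Longrightarrow> a \<le> b \<Longrightarrow> rat_cong p a x y"
  by (auto simp: rat_cong_iff intro: pideal_mono)

lemma rat_cong_add:
  "rat_cong p a x y \<Longrightarrow> rat_cong p a x' y' \<Longrightarrow> rat_cong p a (x + x') (y + y')"
  using pideal_add[of "x - y" a "x' - y'"] by (simp add: rat_cong_iff algebra_simps)

lemma rat_cong_diff:
  "rat_cong p a x y \<Longrightarrow> rat_cong p a x' y' \<Longrightarrow> rat_cong p a (x - x') (y - y')"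
  using pideal_diff[of "x - y" a "x' - y'"] by (simp add: rat_cong_iff algebra_simps)

lemma rat_cong_minus: "rat_cong p a x y \<Longrightarrow> rat_cong p a (- x) (- y)"
  using rat_cong_diff[of a 0 0 x y] by simp

text \<open>The integrality conditions come from splitting \<open>x * x' - y * y'\<close> as
  \<open>x * (x' - y') + (x - y) * y'\<close>.\<close>

lemma rat_cong_mult:
  assumes "rat_cong p a x y" "rat_cong p a x' y'" "x \<in> pideal 0" "y' \<in> pideal 0"
  shows "rat_cong p a (x * x') (y * y')"
proof -
  have "x * (x' - y') + (x - y) * y' \<in> pideal a"
    using assms unfolding rat_cong_iff
    by (intro pideal_add pideal_mult0[of x] pideal_mult0'[of "x - y"])
  then show ?thesis
    by (simp add: rat_cong_iff algebra_simps)
qed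

lemma rat_cong_scale: "rat_cong p a x y \<Longrightarrow> c \<in> pideal 0 \<Longrightarrow> rat_cong p a (c * x) (c * y)"
  using pideal_mult0[of c "x - y" a] by (simp add: rat_cong_iff algebra_simps)

text \<open>A multiplier divisible by \<open>p ^ b\<close> sharpens the modulus by \<open>b\<close>
  powers; this is how the modulus later climbs along the powers of \<open>p\<close>.\<close>

lemma rat_cong_scale_pideal:
  "rat_cong p a x y \<Longrightarrow> c \<in> pideal b \<Longrightarrow> rat_cong p (a + b) (c * x) (c * y)"
  using pideal_mult[of "x - y" a c b] by (simp add: rat_cong_iff algebra_simps)

lemma rat_cong_sum:
  "(\<And>i. i \<in> A \<Longrightarrow> rat_cong p a (f i) (g i)) \<Longrightarrow> rat_cong p a (sum f A) (sum g A)"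
  by (induction A rule: infinite_finite_induct) (auto intro: rat_cong_add)

lemma rat_cong_of_nat:
  assumes "[m = n] (mod p ^ a)"
  shows "rat_cong p a (of_nat m) (of_nat n)"
proof -
  have "int p ^ a dvd int m - int n"
    using assms by (simp add: cong_iff_dvd_diff flip: cong_int_iff)
  from pideal_of_int[OF this] show ?thesis
    by (simp add: rat_cong_iff)
qed

lemma rat_cong_inverse:
  assumes "rat_cong p a (of_nat m) (of_nat n)" "\<not> p dvd m" "\<not> p dvd n"
  shows "rat_cong p a (1 / of_nat m) (1 / of_nat n)"
proof -
  have "(of_nat n - of_nat m) * inverse (of_nat m) * inverse (of_nat n) \<in> pideal a"
    using assms rat_cong_sym[OF assms(1)]
    by (intro pideal_mult0' pideal_inverse_of_nat) (auto simp: rat_cong_iff)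
  moreover have "m \<noteq> 0" "n \<noteq> 0"
    using assms by (auto intro: Nat.gr0I)
  ultimately show ?thesis
    by (simp add: rat_cong_iff field_simps)
qed

end

section \<open>Reduction of triples modulo a period\<close>

text \<open>The arguments are rationals so that expansions around negative points such as
  \<open>- i\<close> are covered as well.\<close>

definition recip3 :: "rat \<Rightarrow> rat \<Rightarrow> rat \<Rightarrow> rat" where
  "recip3 x y z = 1 / (x * y * z)"

text \<open>Generalizes \<open>Z\<close> by separating the sum \<open>n\<close> from the modulus
  \<open>m\<close> of coprimality: both \<open>harmonic_sum (q * p) p\<close> and
  \<open>harmonic_sum (q * p) (p * q)\<close> occur.\<close>

definition harmonic_sum :: "nat \<Rightarrow> nat \<Rightarrow> rat" where
  "harmonic_sum n m = (\<Sum>(i, j, k)\<in>sum_triples n m. recip3 (of_nat i) (of_nat j) (of_nat k))"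

text \<open>The remainders modulo \<open>M\<close> of a triple whose sum is a multiple of
  \<open>M\<close>. They are positive and below \<open>M\<close>, so a nonempty set forces
  \<open>t\<close> to be 1 or 2.\<close>

definition residue_triples :: "nat \<Rightarrow> nat \<Rightarrow> nat \<Rightarrow> (nat \<times> nat \<times> nat) set" where
  "residue_triples M m t = {(i, j, k) \<in> sum_triples (t * M) m. i < M \<and> j < M \<and> k < M}"

text \<open>The quotients by \<open>M\<close> of a triple with sum \<open>n * M\<close> whose
  remainders add up to \<open>t * M\<close>.\<close>

definition simplex :: "nat \<Rightarrow> nat \<Rightarrow> (nat \<times> nat \<times> nat) set" where
  "simplex n t = {(a, b, c). a + b + c + t = n}"

lemma finite_residue_triples [simp]: "finite (residue_triples M m t)"
  by (rule finite_subset[OF _ finite_sum_triples[of "t * M" m]]) (auto simp: residue_triples_def)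

lemma finite_simplex [simp]: "finite (simplex n t)"
  by (rule finite_subset[of _ "{..n} \<times> {..n} \<times> {..n}"]) (auto simp: simplex_def)

lemma residue_triples_1: "residue_triples M m 1 = sum_triples M m"
  by (auto simp: residue_triples_def sum_triples_def coprime_pos_def)

section \<open>Cyclic symmetry of sums over triples\<close>

lemma sum_rotate:
  fixes f :: "'a \<Rightarrow> 'a \<Rightarrow> 'a \<Rightarrow> 'b :: comm_monoid_add"
  assumes "\<And>i j k. (i, j, k) \<in> A \<Longrightarrow> (j, k, i) \<in> A"
  shows "(\<Sum>(i, j, k)\<in>A. f j k i) = (\<Sum>(i, j, k)\<in>A. f i j k)"
  by (rule sum.reindex_bij_witness[of _ "\<lambda>(i, j, k). (k, i, j)" "\<lambda>(i, j, k). (j, k, i)"])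
    (auto intro: assms)

text \<open>The three cyclic shifts contribute equally to a rotation-invariant sum. The resulting
  factor 3 is what saves the argument for \<open>p = 3\<close>.\<close>

lemma sum_cyclic:
  fixes f :: "'a \<Rightarrow> 'a \<Rightarrow> 'a \<Rightarrow> 'b :: comm_semiring_1"
  assumes "\<And>i j k. (i, j, k) \<in> A \<Longrightarrow> (j, k, i) \<in> A"
  shows "(\<Sum>(i, j, k)\<in>A. f i j k + f j k i + f k i j) = 3 * (\<Sum>(i, j, k)\<in>A. f i j k)"
proof -
  have "(\<Sum>(i, j, k)\<in>A. f i j k + f j k i + f k i j)
      = (\<Sum>(i, j, k)\<in>A. f i j k) + (\<Sum>(i, j, k)\<in>A. f j k i) + (\<Sum>(i, j, k)\<in>A. f k i j)"
    by (simp add: split_def sum.distrib)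
  moreover have "(\<Sum>(i, j, k)\<in>A. f k i j) = (\<Sum>(i, j, k)\<in>A. f j k i)"
    using sum_rotate[OF assms, where f = "\<lambda>i j k. f j k i"] by simp
  moreover have "(\<Sum>(i, j, k)\<in>A. f j k i) = (\<Sum>(i, j, k)\<in>A. f i j k)"
    by (rule sum_rotate[OF assms])
  moreover have "3 * s = s + s + s" for s :: 'b
  proof -
    have "3 * s = (1 + 1 + 1) * s"
      by simp
    then show ?thesis
      by (simp only: distrib_right mult_1_left)
  qed
  ultimately show ?thesis
    by simp
qed

lemma sum_triples_rotate: "(i, j, k) \<in> sum_triples n m \<Longrightarrow> (j, k, i) \<in> sum_triples n m"
  by (auto simp: sum_triples_def)

lemma residue_triples_rotate:
  "(i, j, k) \<in> residue_triples M m t \<Longrightarrow> (j, k, i) \<in> residue_triples M m t"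
  by (auto simp: residue_triples_def sum_triples_def)

lemma simplex_rotate: "(i, j, k) \<in> simplex n t \<Longrightarrow> (j, k, i) \<in> simplex n t"
  by (auto simp: simplex_def)

section \<open>Division with remainder and reflection\<close>

text \<open>The condition \<open>Q \<noteq> 1\<close> keeps the remainder away from 0, which is
  coprime to 1 only.\<close>

lemma coprime_pos_mod:
  assumes Q: "Q dvd M" "Q \<noteq> 1" and i: "i \<in> coprime_pos Q"
  shows "i mod M \<in> coprime_pos Q"
proof -
  have c: "coprime (i mod M) Q"
  proof (rule coprimeI)
    fix d assume d: "d dvd i mod M" "d dvd Q"
    then have "d dvd i"
      using Q(1) by (metis dvd_mod_imp_dvd dvd_trans)
    then show "is_unit d"
      using d i by (auto simp: coprime_pos_def dest: coprime_common_divisor)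
  qed
  moreover have "i mod M > 0"
    using c Q(2) by (cases "i mod M = 0") auto
  ultimately show ?thesis
    by (simp add: coprime_pos_def)
qed

lemma coprime_pos_add:
  assumes "Q dvd M" "i \<in> coprime_pos Q"
  shows "i + a * M \<in> coprime_pos Q"
proof -
  have "coprime (i + a * M) Q"
  proof (rule coprimeI)
    fix d assume d: "d dvd i + a * M" "d dvd Q"
    then have "d dvd a * M"
      using assms(1) by (meson dvd_mult dvd_trans)
    then have "d dvd i"
      using d by (simp add: dvd_add_left_iff)
    then show "is_unit d"
      using d assms(2) by (auto simp: coprime_pos_def dest: coprime_common_divisor)
  qed
  then show ?thesis
    using assms(2) by (simp add: coprime_pos_def)
qed

text \<open>Division with remainder by \<open>M\<close> in each coordinate is a bijection: if the
  remainders add up to \<open>t * M\<close>, the quotients add up to \<open>m - t\<close>.\<close>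

lemma sum_triples_period:
  fixes g :: "nat \<Rightarrow> nat \<Rightarrow> nat \<Rightarrow> 'b :: comm_monoid_add"
  assumes Q: "Q dvd M" "Q \<noteq> 1" and M: "M > 0"
  shows "(\<Sum>(i, j, k)\<in>sum_triples (m * M) Q. g i j k) =
    (\<Sum>t\<in>{1, 2}. \<Sum>(i, j, k)\<in>residue_triples M Q t. \<Sum>(a, b, c)\<in>simplex m t.
       g (i + a * M) (j + b * M) (k + c * M))"
proof -
  define S where "S = (SIGMA t:{1, 2}. residue_triples M Q t \<times> simplex m t)"
  \<comment> \<open>The first component is the carry \<open>t\<close>, the sum of the remainders
    divided by \<open>M\<close>.\<close>
  define dec where "dec = (\<lambda>(i, j, k). ((i mod M + j mod M + k mod M) div M,
    (i mod M, j mod M, k mod M), (i div M, j div M, k div M)))"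
  define enc where "enc = (\<lambda>(t :: nat, (i, j, k), (a, b, c)). (i + a * M, j + b * M, k + c * M))"
  have 1: "enc (dec x) = x" for x
    by (auto simp: enc_def dec_def split: prod.splits)
  have 2: "dec x \<in> S" if mem: "x \<in> sum_triples (m * M) Q" for x
  proof -
    obtain i j k where x: "x = (i, j, k)" and s: "i + j + k = m * M"
      and c: "i \<in> coprime_pos Q" "j \<in> coprime_pos Q" "k \<in> coprime_pos Q"
      using mem by (cases x) (auto simp: sum_triples_def)
    define r where "r = i mod M + j mod M + k mod M"
    have cm: "i mod M \<in> coprime_pos Q" "j mod M \<in> coprime_pos Q" "k mod M \<in> coprime_pos Q"
      using coprime_pos_mod[OF Q] c by auto
    have "r + (i div M + j div M + k div M) * M
        = (i div M * M + i mod M) + (j div M * M + j mod M) + (k div M * M + k mod M)"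
      unfolding r_def by (simp only: distrib_right add_ac)
    then have rs: "r + (i div M + j div M + k div M) * M = m * M"
      by (simp only: div_mult_mod_eq s)
    then have "M dvd r"
      by (metis dvd_add_left_iff dvd_triv_right)
    then obtain t where t: "r = t * M"
      by (metis dvd_def mult.commute)
    have "i mod M > 0" "i mod M < M" "j mod M < M" "k mod M < M"
      using cm M by (auto simp: coprime_pos_def)
    then have "0 < r" "r < 3 * M"
      unfolding r_def by linarith+
    then have t12: "t = 1 \<or> t = 2"
      unfolding t using M by (simp, linarith)
    have div: "r div M = t"
      using M t by simp
    have "(i div M + j div M + k div M + t) * M = m * M"
      using rs t by (simp add: algebra_simps)
    then have "i div M + j div M + k div M + t = m"
      using M by simp
    moreover have "(i mod M, j mod M, k mod M) \<in> residue_triples M Q t"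
      using t cm M by (simp add: residue_triples_def sum_triples_def r_def)
    ultimately show ?thesis
      using t12 div by (simp add: x S_def dec_def simplex_def r_def)
  qed
  have 3: "dec (enc y) = y" "enc y \<in> sum_triples (m * M) Q" if mem: "y \<in> S" for y
  proof -
    obtain t i j k a b c where y: "y = (t, (i, j, k), (a, b, c))"
      and r: "(i, j, k) \<in> residue_triples M Q t" and s: "a + b + c + t = m"
      using mem by (cases y) (auto simp: S_def simplex_def)
    have lt: "i < M" "j < M" "k < M" and sum: "i + j + k = t * M"
      and c: "i \<in> coprime_pos Q" "j \<in> coprime_pos Q" "k \<in> coprime_pos Q"
      using r by (auto simp: residue_triples_def sum_triples_def)
    show "dec (enc y) = y"
      using lt sum M by (simp add: y enc_def dec_def)
    have "i + a * M + (j + b * M) + (k + c * M) = (i + j + k) + (a + b + c) * M"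
      by (simp add: algebra_simps)
    also have "\<dots> = m * M"
      using sum s by (simp add: algebra_simps flip: s)
    finally show "enc y \<in> sum_triples (m * M) Q"
      using coprime_pos_add[OF Q(1)] c by (simp add: y enc_def sum_triples_def)
  qed
  have "(\<Sum>(i, j, k)\<in>sum_triples (m * M) Q. g i j k) =
    (\<Sum>y\<in>S. case enc y of (i, j, k) \<Rightarrow> g i j k)"
    by (rule sum.reindex_bij_witness[of _ enc dec]) (simp_all only: 1 2 3)
  also have "\<dots> = (\<Sum>t\<in>{1, 2}. \<Sum>z\<in>residue_triples M Q t \<times> simplex m t.
      case enc (t, z) of (i, j, k) \<Rightarrow> g i j k)"
    unfolding S_def by (subst sum.Sigma) (auto simp: split_def)
  also have "\<dots> = (\<Sum>t\<in>{1, 2}. \<Sum>x\<in>residue_triples M Q t. \<Sum>y\<in>simplex m t.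
      case enc (t, x, y) of (i, j, k) \<Rightarrow> g i j k)"
    by (simp only: sum.cartesian_product split_def prod.collapse)
  finally show ?thesis
    by (simp only: enc_def split_def fst_conv snd_conv)
qed

text \<open>Replacing every entry \<open>i\<close> by \<open>M - i\<close> turns the sum
  \<open>2 * M\<close> into \<open>3 * M - 2 * M\<close>, and preserves coprimality to the divisor
  \<open>Q\<close> of \<open>M\<close>.\<close>

lemma sum_residue_triples_reflect:
  fixes g :: "nat \<Rightarrow> nat \<Rightarrow> nat \<Rightarrow> 'b :: comm_monoid_add"
  assumes Q: "Q dvd M"
  shows "(\<Sum>(i, j, k)\<in>residue_triples M Q 2. g i j k) =
    (\<Sum>(i, j, k)\<in>residue_triples M Q 1. g (M - i) (M - j) (M - k))"
proof -
  have c: "M - i \<in> coprime_pos Q" if "i \<in> coprime_pos Q" "i < M" for i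
  proof -
    have "coprime (M - i) Q"
    proof (rule coprimeI)
      fix d assume d: "d dvd M - i" "d dvd Q"
      then have "d dvd M"
        using Q by (blast intro: dvd_trans)
      then have "d dvd i"
        using d that(2) by (metis dvd_diffD1 less_imp_le)
      then show "is_unit d"
        using d that(1) by (auto simp: coprime_pos_def dest: coprime_common_divisor)
    qed
    then show ?thesis
      using that by (simp add: coprime_pos_def)
  qed
  define r where "r = (\<lambda>(i, j, k). (M - i, M - j, M - k))"
  \<comment> \<open>Both directions, \<open>t = 1\<close> and \<open>t = 2\<close>, are treated at
    once, so that \<open>r\<close> can serve as its own inverse.\<close>
  have r: "r x \<in> residue_triples M Q t'" "r (r x) = x"
    if x: "x \<in> residue_triples M Q t" and t: "t + t' = 3" for x t t'
  proof -
    obtain i j k where ijk: "x = (i, j, k)"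
      by (cases x)
    have lt: "i < M" "j < M" "k < M" and sum: "i + j + k = t * M"
      and cop: "i \<in> coprime_pos Q" "j \<in> coprime_pos Q" "k \<in> coprime_pos Q"
      using x by (auto simp: ijk residue_triples_def sum_triples_def)
    have "(M - i) + (M - j) + (M - k) + t * M = (t + t') * M"
      using lt by (simp add: t flip: sum)
    then have "(M - i) + (M - j) + (M - k) = t' * M"
      by (simp add: distrib_right)
    moreover have "i > 0" "j > 0" "k > 0"
      using cop by (auto simp: coprime_pos_def)
    ultimately show "r x \<in> residue_triples M Q t'"
      using lt cop c by (simp add: ijk r_def residue_triples_def sum_triples_def)
    show "r (r x) = x"
      using lt by (simp add: ijk r_def)
  qed
  have "(\<Sum>(i, j, k)\<in>residue_triples M Q 2. g i j k)
    = (\<Sum>x\<in>residue_triples M Q 1. case r x of (i, j, k) \<Rightarrow> g i j k)"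
    by (rule sum.reindex_bij_witness[of _ r r]) (use r[of _ 1 2] r[of _ 2 1] in simp_all)
  then show ?thesis
    by (simp add: r_def split_def)
qed

section \<open>Counting the triples of quotients\<close>

text \<open>The first two coordinates determine the third. Writing the total as \<open>n + t\<close>
  avoids truncated subtraction, and doubling avoids division.\<close>

lemma card_simplex: "2 * card (simplex (n + t) t) = (n + 1) * (n + 2)"
proof -
  have "card (simplex (n + t) t) = card (SIGMA a:{..n}. {..n - a})"
    by (rule bij_betw_same_card[of "\<lambda>(a, b, c). (a, b)"], rule bij_betwI[of _ _ _
          "\<lambda>(a, b). (a, b, n - a - b)"]) (auto simp: simplex_def)
  also have "\<dots> = (\<Sum>a\<le>n. n - a + 1)"
    by simp
  also have "\<dots> = (\<Sum>a\<le>n. a + 1)"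
    by (rule sum.reindex_bij_witness[of _ "\<lambda>a. n - a" "\<lambda>a. n - a"]) auto
  also have "2 * \<dots> = (n + 1) * (n + 2)"
    by (induction n) auto
  finally show ?thesis .
qed

text \<open>The small values of \<open>m\<close> for which the simplex is empty fit too, as the
  right-hand side is then 0. The two counts differ by \<open>m\<close>, which is the factor in
  \<open>harmonic_sum_period\<close>.\<close>

lemma card_simplex_1: "2 * card (simplex m 1) = m * (m + 1)"
  and card_simplex_2: "2 * card (simplex m 2) = m * (m - 1)"
proof -
  have *: "simplex 0 1 = {}" "simplex 0 2 = {}" "simplex 1 2 = {}"
    by (auto simp: simplex_def)
  show "2 * card (simplex m 1) = m * (m + 1)"
    using card_simplex[of "m - 1" 1] * by (cases m) auto
  show "2 * card (simplex m 2) = m * (m - 1)"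
  proof (cases "m \<ge> 2")
    case True
    then obtain n where "m = n + 2"
      by (metis add.commute le_Suc_ex)
    then show ?thesis
      using card_simplex[of n 2] by simp
  next
    case False
    then have "m = 0 \<or> m = 1"
      by auto
    then show ?thesis
      using * by auto
  qed
qed

text \<open>By rotation all coordinates have the same total, and at each point they add up to
  \<open>m - t\<close>. For \<open>m < t\<close> the subtraction truncates, but the simplex is
  empty.\<close>

lemma sum_simplex_coordinate: "3 * (\<Sum>(a, b, c)\<in>simplex m t. a) = (m - t) * card (simplex m t)"
proof -
  have "3 * (\<Sum>(a, b, c)\<in>simplex m t. a) = (\<Sum>(a, b, c)\<in>simplex m t. a + b + c)"
    using sum_cyclic[of "simplex m t" "\<lambda>a b c. a", OF simplex_rotate] by simp
  also have "\<dots> = (\<Sum>(a, b, c)\<in>simplex m t. m - t)"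
    by (rule sum.cong) (auto simp: simplex_def)
  finally show ?thesis
    by (simp add: split_def)
qed

text \<open>Equality of the coordinate totals makes the linear term of the expansion symmetric in
  \<open>x\<close>, \<open>y\<close>, \<open>z\<close>.\<close>

lemma sum_simplex_linear:
  fixes x y z :: rat
  shows "(\<Sum>(a, b, c)\<in>simplex m t. of_nat a * x + of_nat b * y + of_nat c * z)
    = of_nat (\<Sum>(a, b, c)\<in>simplex m t. a) * (x + y + z)"
proof -
  have r: "(\<Sum>(a, b, c)\<in>simplex m t. of_nat b :: rat) = (\<Sum>(a, b, c)\<in>simplex m t. of_nat a)"
    "(\<Sum>(a, b, c)\<in>simplex m t. of_nat c :: rat) = (\<Sum>(a, b, c)\<in>simplex m t. of_nat b)"
    using sum_rotate[OF simplex_rotate[of _ _ _ m t], where f = "\<lambda>a b c. of_nat a :: rat"]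
      sum_rotate[OF simplex_rotate[of _ _ _ m t], where f = "\<lambda>a b c. of_nat b :: rat"]
    by auto
  have "(\<Sum>(a, b, c)\<in>simplex m t. of_nat a * x + of_nat b * y + of_nat c * z)
    = (\<Sum>(a, b, c)\<in>simplex m t. of_nat a) * x + (\<Sum>(a, b, c)\<in>simplex m t. of_nat b) * y
      + (\<Sum>(a, b, c)\<in>simplex m t. of_nat c) * z"
    by (simp only: split_def sum.distrib sum_distrib_right)
  then show ?thesis
    by (simp only: r) (simp add: algebra_simps split_def)
qed

lemma recip3_mult: "recip3 x y z = 1 / x * (1 / y) * (1 / z)"
  by (simp add: recip3_def)

lemma recip3_rotate: "recip3 y z x = recip3 x y z"
  by (simp add: recip3_def mult_ac)

section \<open>First-order expansion of reciprocals\<close>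

context odd_prime
begin

text \<open>A geometric series cut after the linear term; with \<open>h = y - x\<close> the exact
  error is \<open>h ^ 2 / (x ^ 2 * y)\<close>.\<close>

lemma inverse_expand:
  assumes x: "x \<noteq> 0" "1 / x \<in> pideal 0" and y: "y \<noteq> 0" "1 / y \<in> pideal 0"
    and d: "y - x \<in> pideal a"
  shows "rat_cong p (2 * a) (1 / y) (1 / x * (1 - (y - x) * (1 / x)))"
proof -
  have "(y - x) * (y - x) * (1 / x) * (1 / x) * (1 / y) \<in> pideal (a + a)"
    using x y d by (intro pideal_mult0' pideal_mult)
  moreover have "1 / y - 1 / x * (1 - (y - x) * (1 / x)) = (y - x) * (y - x) * (1 / x) * (1 / x) * (1 / y)"
    using x(1) y(1) by (simp add: field_simps)
  ultimately show ?thesis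
    by (simp add: rat_cong_iff mult_2)
qed

text \<open>Three expansions are multiplied, and every product of two relative increments lies in
  \<open>pideal (2 * a)\<close>. Encoding the points as functions of an index lets one hypothesis
  cover all three coordinates.\<close>

lemma recip3_expand:
  assumes x: "\<And>i. i < 3 \<Longrightarrow> x i \<noteq> 0 \<and> 1 / x i \<in> pideal 0"
    and y: "\<And>i. i < 3 \<Longrightarrow> y i \<noteq> 0 \<and> 1 / y i \<in> pideal 0"
    and d: "\<And>i. i < 3 \<Longrightarrow> y i - x i \<in> pideal a"
  shows "rat_cong p (2 * a) (recip3 (y 0) (y 1) (y 2))
    (recip3 (x 0) (x 1) (x 2) *
      (1 - ((y 0 - x 0) / x 0 + (y 1 - x 1) / x 1 + (y 2 - x (2 :: nat)) / x 2)))"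
proof -
  define u where "u i = (y i - x i) * (1 / x i)" for i
  have u: "u i \<in> pideal a" if "i < 3" for i
    unfolding u_def using x y d that by (intro pideal_mult0') auto
  have u0: "u i \<in> pideal 0" if "i < 3" for i
    using u[OF that] by (rule pideal_mono) simp
  have e: "rat_cong p (2 * a) (1 / y i) (1 / x i * (1 - u i))" if "i < 3" for i
    unfolding u_def using x y d that by (intro inverse_expand) auto
  have i: "1 / x i * (1 - u i) \<in> pideal 0" if "i < 3" for i
    using x u0 that by (intro pideal_mult0 pideal_diff) auto
  have "rat_cong p (2 * a) (recip3 (y 0) (y 1) (y 2))
    (1 / x 0 * (1 - u 0) * (1 / x 1 * (1 - u 1)) * (1 / x 2 * (1 - u 2)))"
    unfolding recip3_mult using y by (intro rat_cong_mult e i pideal_mult0) auto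
  moreover have "rat_cong p (2 * a) ((1 - u 0) * (1 - u 1) * (1 - u 2)) (1 - (u 0 + u 1 + u 2))"
  proof -
    have "u 0 * u 1 + u 0 * u 2 + u 1 * u 2 - u 0 * u 1 * u 2 \<in> pideal (a + a)"
      by (intro pideal_add pideal_diff pideal_mult pideal_mult0' u u0) auto
    then show ?thesis
      by (simp add: rat_cong_iff algebra_simps flip: mult_2)
  qed
  then have "rat_cong p (2 * a) (recip3 (x 0) (x 1) (x 2) * ((1 - u 0) * (1 - u 1) * (1 - u 2)))
    (recip3 (x 0) (x 1) (x 2) * (1 - (u 0 + u 1 + u 2)))"
    by (rule rat_cong_scale) (unfold recip3_mult, intro pideal_mult0, use x in auto)
  ultimately show ?thesis
    by (simp add: recip3_mult u_def mult_ac) (erule (1) rat_cong_trans)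
qed

lemma unit_of_nat: "\<not> p dvd n \<Longrightarrow> of_nat n \<noteq> (0 :: rat) \<and> 1 / of_nat n \<in> pideal 0"
  using pideal_inverse_of_nat[of n] by (cases "n = 0") (auto simp: divide_inverse)

lemma recip3_in_pideal0:
  "\<not> p dvd i \<Longrightarrow> \<not> p dvd j \<Longrightarrow> \<not> p dvd k \<Longrightarrow> recip3 (of_nat i) (of_nat j) (of_nat k) \<in> pideal 0"
  unfolding recip3_mult by (intro pideal_mult0) (auto simp: unit_of_nat)

text \<open>The increments are multiples of \<open>M\<close>. Since \<open>a > 0\<close>,
  \<open>p\<close> divides \<open>M\<close>, so the shifted denominators stay prime to
  \<open>p\<close>.\<close>

lemma recip3_shift:
  assumes ijk: "\<not> p dvd i" "\<not> p dvd j" "\<not> p dvd k" and M: "p ^ a dvd M" "a > 0"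
  shows "rat_cong p (2 * a)
    (recip3 (of_nat (i + b * M)) (of_nat (j + c * M)) (of_nat (k + d * M)))
    (recip3 (of_nat i) (of_nat j) (of_nat k) *
       (1 - of_nat M * (of_nat b * (1 / of_nat i) + of_nat c * (1 / of_nat j) + of_nat d * (1 / of_nat k))))"
proof -
  have pM: "p dvd M"
    using M dvd_power[of a p] by (meson dvd_trans)
  define x :: "nat \<Rightarrow> rat" where "x = (\<lambda>_. 0)(0 := of_nat i, 1 := of_nat j, 2 := of_nat k)"
  define y :: "nat \<Rightarrow> rat" where
    "y = (\<lambda>_. 0)(0 := of_nat (i + b * M), 1 := of_nat (j + c * M), 2 := of_nat (k + d * M))"
  have nd: "\<not> p dvd n + e * M" if "\<not> p dvd n" for n e
    using that pM by (metis dvd_add_left_iff dvd_mult)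
  have lt3: "(n < 3) \<longleftrightarrow> n = 0 \<or> n = 1 \<or> n = 2" for n :: nat
    by auto
  have bM: "of_nat (e * M) \<in> pideal a" for e
    using M(1) by (intro pideal_of_nat) auto
  have "rat_cong p (2 * a) (recip3 (y 0) (y 1) (y 2))
    (recip3 (x 0) (x 1) (x 2) *
      (1 - ((y 0 - x 0) / x 0 + (y 1 - x 1) / x 1 + (y 2 - x 2) / x 2)))"
    by (rule recip3_expand)
      (use unit_of_nat[OF ijk(1)] unit_of_nat[OF ijk(2)] unit_of_nat[OF ijk(3)]
        unit_of_nat[OF nd[OF ijk(1)], of b] unit_of_nat[OF nd[OF ijk(2)], of c]
        unit_of_nat[OF nd[OF ijk(3)], of d] bM[of b] bM[of c] bM[of d]
        in \<open>auto simp: lt3 x_def y_def\<close>)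
  then show ?thesis
    by (simp add: x_def y_def algebra_simps)
qed

text \<open>The expansion is made around \<open>- i\<close>, from which \<open>M - i\<close> differs
  by \<open>M\<close>. Three sign changes give the minus in front, and dividing by
  \<open>- i\<close> gives the plus in the correction.\<close>

lemma recip3_reflect:
  assumes ijk: "\<not> p dvd i" "\<not> p dvd j" "\<not> p dvd k" and M: "p ^ a dvd M" "a > 0"
    and lt: "i < M" "j < M" "k < M"
  shows "rat_cong p (2 * a) (recip3 (of_nat (M - i)) (of_nat (M - j)) (of_nat (M - k)))
    (- recip3 (of_nat i) (of_nat j) (of_nat k) *
       (1 + of_nat M * (1 / of_nat i + 1 / of_nat j + 1 / of_nat k)))"
proof -
  have pM: "p dvd M"
    using M dvd_power[of a p] by (meson dvd_trans)
  define x :: "nat \<Rightarrow> rat" where "x = (\<lambda>_. 0)(0 := - of_nat i, 1 := - of_nat j, 2 := - of_nat k)"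
  define y :: "nat \<Rightarrow> rat" where
    "y = (\<lambda>_. 0)(0 := of_nat (M - i), 1 := of_nat (M - j), 2 := of_nat (M - k))"
  have nd: "\<not> p dvd M - n" if "\<not> p dvd n" "n < M" for n
    using that pM by (metis dvd_diffD1 less_imp_le)
  have lt3: "(n < 3) \<longleftrightarrow> n = 0 \<or> n = 1 \<or> n = 2" for n :: nat
    by auto
  have bM: "of_nat M \<in> pideal a"
    using M(1) by (rule pideal_of_nat)
  have neg: "- (1 / of_nat n) \<in> pideal 0" if "\<not> p dvd n" for n
    using unit_of_nat[OF that] pideal_minus by blast
  have "rat_cong p (2 * a) (recip3 (y 0) (y 1) (y 2))
    (recip3 (x 0) (x 1) (x 2) *
      (1 - ((y 0 - x 0) / x 0 + (y 1 - x 1) / x 1 + (y 2 - x 2) / x 2)))"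
    by (rule recip3_expand)
      (use unit_of_nat[OF ijk(1)] unit_of_nat[OF ijk(2)] unit_of_nat[OF ijk(3)]
        unit_of_nat[OF nd[OF ijk(1) lt(1)]] unit_of_nat[OF nd[OF ijk(2) lt(2)]]
        unit_of_nat[OF nd[OF ijk(3) lt(3)]] bM neg[OF ijk(1)] neg[OF ijk(2)] neg[OF ijk(3)] lt
        in \<open>auto simp: lt3 x_def y_def of_nat_diff\<close>)
  then show ?thesis
    using lt by (simp add: x_def y_def of_nat_diff recip3_def algebra_simps)
qed

lemma coprime_pos_not_dvd: "i \<in> coprime_pos Q \<Longrightarrow> p dvd Q \<Longrightarrow> \<not> p dvd i"
  using prime_p by (auto simp: coprime_pos_def dest: coprime_common_divisor)

section \<open>Sums over residue triples and their periodicity\<close>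

text \<open>The linear correction consists of three rotations of one integral sum, so the factor 3
  can be split off. It gives an additional power of \<open>p\<close> when
  \<open>p = 3\<close>.\<close>

lemma recip3_cyclic_sum:
  assumes A: "A \<subseteq> residue_triples M Q t" "\<And>i j k. (i, j, k) \<in> A \<Longrightarrow> (j, k, i) \<in> A"
    and Q: "p dvd Q"
  obtains Y where "Y \<in> pideal 0"
    "(\<Sum>(i, j, k)\<in>A. recip3 (of_nat i) (of_nat j) (of_nat k)
       * (1 / of_nat i + 1 / of_nat j + 1 / of_nat k)) = 3 * Y"
proof
  let ?r = "\<lambda>i j k. recip3 (of_nat i) (of_nat j) (of_nat k)"
  let ?Y = "\<Sum>(i, j, k)\<in>A. ?r i j k * (1 / of_nat i)"
  show "?Y \<in> pideal 0"
  proof (rule pideal_sum, clarify)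
    fix i j k assume "(i, j, k) \<in> A"
    then have "\<not> p dvd i" "\<not> p dvd j" "\<not> p dvd k"
      using A(1) coprime_pos_not_dvd[OF _ Q] by (auto simp: residue_triples_def sum_triples_def)
    then show "?r i j k * (1 / of_nat i) \<in> pideal 0"
      using unit_of_nat by (intro pideal_mult0 recip3_in_pideal0) auto
  qed
  have "(\<Sum>(i, j, k)\<in>A. ?r i j k * (1 / of_nat i + 1 / of_nat j + 1 / of_nat k))
    = (\<Sum>(i, j, k)\<in>A. ?r i j k * (1 / of_nat i) + ?r j k i * (1 / of_nat j)
       + ?r k i j * (1 / of_nat k))"
    by (simp add: recip3_rotate distrib_left)
  also have "\<dots> = 3 * ?Y"
    by (rule sum_cyclic[OF A(2)])
  finally show "(\<Sum>(i, j, k)\<in>A. ?r i j k * (1 / of_nat i + 1 / of_nat j + 1 / of_nat k)) = 3 * ?Y" .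
qed

text \<open>The quadratic error is controlled by \<open>e \<le> a\<close>. The linear one is
  \<open>M\<close> times 3 times an integral sum, hence it vanishes modulo
  \<open>p ^ (a + e)\<close> whenever \<open>3 \<in> pideal e\<close>.\<close>

lemma sum_recip3_reflect:
  assumes A: "A \<subseteq> residue_triples M Q t" "\<And>i j k. (i, j, k) \<in> A \<Longrightarrow> (j, k, i) \<in> A"
    and M: "p ^ a dvd M" "a > 0" and Q: "p dvd Q" and e: "e \<le> a" "3 \<in> pideal e"
  shows "rat_cong p (a + e)
    (\<Sum>(i, j, k)\<in>A. recip3 (of_nat (M - i)) (of_nat (M - j)) (of_nat (M - k)))
    (- (\<Sum>(i, j, k)\<in>A. recip3 (of_nat i) (of_nat j) (of_nat k)))"
proof -
  let ?r = "\<lambda>i j k. recip3 (of_nat i) (of_nat j) (of_nat k)"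
  have nd: "\<not> p dvd i" "\<not> p dvd j" "\<not> p dvd k" "i < M" "j < M" "k < M" if "(i, j, k) \<in> A" for i j k
    using that A(1) coprime_pos_not_dvd[OF _ Q] by (auto simp: residue_triples_def sum_triples_def)
  have "rat_cong p (a + e) (\<Sum>(i, j, k)\<in>A. recip3 (of_nat (M - i)) (of_nat (M - j)) (of_nat (M - k)))
    (\<Sum>(i, j, k)\<in>A. - ?r i j k * (1 + of_nat M * (1 / of_nat i + 1 / of_nat j + 1 / of_nat k)))"
  proof (rule rat_cong_sum, clarify)
    fix i j k assume ijk: "(i, j, k) \<in> A"
    show "rat_cong p (a + e) (recip3 (of_nat (M - i)) (of_nat (M - j)) (of_nat (M - k)))
        (- ?r i j k * (1 + of_nat M * (1 / of_nat i + 1 / of_nat j + 1 / of_nat k)))"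
      using recip3_reflect[OF nd(1-3)[OF ijk] M nd(4-6)[OF ijk]] by (rule rat_cong_mono) (use e in auto)
  qed
  also have "(\<Sum>(i, j, k)\<in>A. - ?r i j k * (1 + of_nat M * (1 / of_nat i + 1 / of_nat j + 1 / of_nat k)))
     = - (\<Sum>(i, j, k)\<in>A. ?r i j k)
       - of_nat M * (\<Sum>(i, j, k)\<in>A. ?r i j k * (1 / of_nat i + 1 / of_nat j + 1 / of_nat k))"
    by (simp add: sum_distrib_left sum_negf[symmetric] sum_subtractf[symmetric] split_def
        algebra_simps)
  also have "rat_cong p (a + e) \<dots> (- (\<Sum>(i, j, k)\<in>A. ?r i j k))"
  proof -
    obtain Y where Y: "Y \<in> pideal 0"
      "(\<Sum>(i, j, k)\<in>A. ?r i j k * (1 / of_nat i + 1 / of_nat j + 1 / of_nat k)) = 3 * Y"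
      using recip3_cyclic_sum[OF A Q] by blast
    have "of_nat M * (3 * Y) \<in> pideal (a + e)"
      using e pideal_of_nat[OF M(1)] Y(1) by (intro pideal_mult pideal_mult0')
    then show ?thesis
      by (auto simp: rat_cong_iff Y(2) dest: pideal_minus)
  qed
  finally show ?thesis .
qed

text \<open>Summing the expansion over all quotients, the constant term is counted once per point of
  the simplex. The linear term drops out because the coordinate total inherits a divisor from the
  number of points.\<close>

lemma sum_residue_triples_period:
  assumes M: "p ^ a dvd M" "a > 0" and Q: "p dvd Q" and m: "p ^ e dvd m" "e \<le> 1"
    and t: "p ^ e dvd card (simplex m t)"
  shows "rat_cong p (a + e)
    (\<Sum>(i, j, k)\<in>residue_triples M Q t. \<Sum>(b, c, d)\<in>simplex m t.
       recip3 (of_nat (i + b * M)) (of_nat (j + c * M)) (of_nat (k + d * M)))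
    (of_nat (card (simplex m t)) *
      (\<Sum>(i, j, k)\<in>residue_triples M Q t. recip3 (of_nat i) (of_nat j) (of_nat k)))"
proof -
  let ?r = "\<lambda>i j k. recip3 (of_nat i) (of_nat j) (of_nat k)"
  let ?R = "residue_triples M Q t" and ?N = "card (simplex m t)"
  define A where "A = (\<Sum>(b, c, d)\<in>simplex m t. b)"
  have "rat_cong p (a + e)
    (\<Sum>(i, j, k)\<in>?R. \<Sum>(b, c, d)\<in>simplex m t. ?r (i + b * M) (j + c * M) (k + d * M))
    (\<Sum>(i, j, k)\<in>?R. \<Sum>(b, c, d)\<in>simplex m t. ?r i j k * (1 - of_nat M *
      (of_nat b * (1 / of_nat i) + of_nat c * (1 / of_nat j) + of_nat d * (1 / of_nat k))))"
  proof (intro rat_cong_sum, clarify, intro rat_cong_sum, clarify)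
    fix i j k b c d assume "(i, j, k) \<in> ?R"
    then have nd: "\<not> p dvd i" "\<not> p dvd j" "\<not> p dvd k"
      using coprime_pos_not_dvd[OF _ Q] by (auto simp: residue_triples_def sum_triples_def)
    show "rat_cong p (a + e) (?r (i + b * M) (j + c * M) (k + d * M)) (?r i j k * (1 - of_nat M *
      (of_nat b * (1 / of_nat i) + of_nat c * (1 / of_nat j) + of_nat d * (1 / of_nat k))))"
      using recip3_shift[OF nd M] by (rule rat_cong_mono) (use m M in auto)
  qed
  also have "(\<Sum>(i, j, k)\<in>?R. \<Sum>(b, c, d)\<in>simplex m t. ?r i j k * (1 - of_nat M *
      (of_nat b * (1 / of_nat i) + of_nat c * (1 / of_nat j) + of_nat d * (1 / of_nat k))))
    = (\<Sum>(i, j, k)\<in>?R. ?r i j k * (of_nat ?N - of_nat M *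
        (of_nat A * (1 / of_nat i + 1 / of_nat j + 1 / of_nat k))))"
  proof (intro sum.cong refl, clarify)
    fix i j k
    have "(\<Sum>(b, c, d)\<in>simplex m t. ?r i j k * (1 - of_nat M *
        (of_nat b * (1 / of_nat i) + of_nat c * (1 / of_nat j) + of_nat d * (1 / of_nat k))))
      = ?r i j k * (of_nat ?N - of_nat M * (\<Sum>(b, c, d)\<in>simplex m t.
        of_nat b * (1 / of_nat i) + of_nat c * (1 / of_nat j) + of_nat d * (1 / of_nat k)))"
      by (simp only: split_def sum_distrib_left[symmetric] sum_subtractf sum_constant mult_1_right)
    then show "(\<Sum>(b, c, d)\<in>simplex m t. ?r i j k * (1 - of_nat M *
        (of_nat b * (1 / of_nat i) + of_nat c * (1 / of_nat j) + of_nat d * (1 / of_nat k))))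
      = ?r i j k * (of_nat ?N - of_nat M *
        (of_nat A * (1 / of_nat i + 1 / of_nat j + 1 / of_nat k)))"
      by (simp only: sum_simplex_linear A_def)
  qed
  also have "\<dots> = of_nat ?N * (\<Sum>(i, j, k)\<in>?R. ?r i j k)
      - of_nat M * (of_nat A * (\<Sum>(i, j, k)\<in>?R. ?r i j k * (1 / of_nat i + 1 / of_nat j + 1 / of_nat k)))"
    by (simp only: split_def sum_distrib_left sum_subtractf[symmetric])
      (simp add: algebra_simps)
  also have "rat_cong p (a + e) \<dots> (of_nat ?N * (\<Sum>(i, j, k)\<in>?R. ?r i j k))"
  proof -
    obtain Y where Y: "Y \<in> pideal 0"
      "(\<Sum>(i, j, k)\<in>?R. ?r i j k * (1 / of_nat i + 1 / of_nat j + 1 / of_nat k)) = 3 * Y"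
      using recip3_cyclic_sum[OF order.refl residue_triples_rotate Q] by blast
    \<comment> \<open>The 3 from rotating \<open>(i, j, k)\<close> is spent on
      \<open>sum_simplex_coordinate\<close>, so nothing has to be divided by 3, even for
      \<open>p = 3\<close>.\<close>
    have "of_nat A * (3 * Y) = of_nat (m - t) * of_nat ?N * Y"
      using arg_cong[OF sum_simplex_coordinate[of m t, folded A_def], of "of_nat :: nat \<Rightarrow> rat"]
      by simp
    moreover have "of_nat M * (of_nat (m - t) * of_nat ?N * Y) \<in> pideal (a + e)"
      using pideal_of_nat[OF M(1)] pideal_of_nat[OF t] Y(1)
      by (intro pideal_mult pideal_mult0' pideal_mult0) auto
    ultimately have "of_nat M * (of_nat A * (3 * Y)) \<in> pideal (a + e)"
      by (simp only:)
    then show ?thesis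
      by (auto simp: rat_cong_iff Y(2) dest: pideal_minus)
  qed
  finally show ?thesis .
qed

text \<open>The remainders with sum \<open>2 * M\<close> reflect to the negatives of those with sum
  \<open>M\<close>, so only the difference of the two simplex counts remains, which is
  \<open>m\<close>.\<close>

lemma harmonic_sum_period:
  assumes M: "p ^ a dvd M" "a > 0" "M > 0" and Q: "p dvd Q" "Q dvd M"
    and m: "p ^ e dvd m" "e \<le> 1"
  shows "rat_cong p (a + e) (harmonic_sum (m * M) Q) (of_nat m * harmonic_sum M Q)"
proof -
  let ?r = "\<lambda>i j k. recip3 (of_nat i) (of_nat j) (of_nat k)"
  let ?N = "\<lambda>t. card (simplex m t)"
  define X where "X t = (\<Sum>(i, j, k)\<in>residue_triples M Q t. ?r i j k)" for t
  define S where "S t = (\<Sum>(i, j, k)\<in>residue_triples M Q t. \<Sum>(b, c, d)\<in>simplex m t.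
       ?r (i + b * M) (j + c * M) (k + d * M))" for t
  \<comment> \<open>As \<open>p\<close> is odd, divisibility passes from the doubled counts to the
    counts.\<close>
  have "coprime (p ^ e) 2"
    using odd_p by simp
  moreover have "p ^ e dvd 2 * ?N 1" "p ^ e dvd 2 * ?N 2"
    unfolding card_simplex_1 card_simplex_2 using m(1) by auto
  ultimately have dvd: "p ^ e dvd ?N 1" "p ^ e dvd ?N 2"
    by (auto simp: coprime_dvd_mult_right_iff)
  have "2 * ?N 1 = 2 * (?N 2 + m)"
    unfolding distrib_left card_simplex_1 card_simplex_2 by (cases m) (auto simp: algebra_simps)
  then have N: "?N 1 = ?N 2 + m"
    by simp
  have "Q \<noteq> 1"
    using Q(1) prime_p by auto
  then have "harmonic_sum (m * M) Q = S 1 + S 2"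
    unfolding harmonic_sum_def S_def
    by (subst sum_triples_period[OF Q(2) _ M(3)]) simp_all
  also have "rat_cong p (a + e) \<dots> (of_nat (?N 1) * X 1 + of_nat (?N 2) * X 2)"
    unfolding S_def X_def
    by (intro rat_cong_add sum_residue_triples_period M(1,2) Q(1) m dvd)
  \<comment> \<open>\<open>X 2\<close> is congruent to \<open>- X 1\<close> modulo
    \<open>p ^ a\<close> here; the divisor \<open>p ^ e\<close> of its coefficient supplies the
    rest.\<close>
  also have "rat_cong p (a + e) \<dots> (of_nat (?N 1) * X 1 + of_nat (?N 2) * (- X 1))"
  proof (intro rat_cong_add rat_cong_refl rat_cong_scale_pideal[OF _ pideal_of_nat[OF dvd(2)]])
    have "X 2 = (\<Sum>(i, j, k)\<in>residue_triples M Q 1. ?r (M - i) (M - j) (M - k))"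
      unfolding X_def by (rule sum_residue_triples_reflect[OF Q(2)])
    then show "rat_cong p a (X 2) (- X 1)"
      using sum_recip3_reflect[OF order.refl residue_triples_rotate M(1,2) Q(1), where e = 0 and t = 1]
      by (simp add: X_def)
  qed
  also have "of_nat (?N 1) * X 1 + of_nat (?N 2) * (- X 1) = of_nat m * X 1"
    by (simp only: N of_nat_add) (simp add: algebra_simps)
  also have "X 1 = harmonic_sum M Q"
    by (simp only: X_def residue_triples_1 harmonic_sum_def)
  finally show ?thesis .
qed

section \<open>The alternating sum, by parity of the entries\<close>

lemma alternating_sum:
  assumes N: "p ^ a dvd N" "a > 0" "odd N" and Q: "p dvd Q" "Q dvd N"
  shows "rat_cong p a
    (\<Sum>(i, j, k)\<in>sum_triples N Q. (- 1) ^ i * recip3 (of_nat i) (of_nat j) (of_nat k))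
    (- (1 / 4) * harmonic_sum N Q)"
proof -
  let ?r = "\<lambda>i j k. recip3 (of_nat i) (of_nat j) (of_nat k)"
  define R where "R = residue_triples N Q 1"
  define O3 where "O3 = {(i, j, k) \<in> R. odd i \<and> odd j \<and> odd k}"
  define oee where "oee i j k = (if odd i \<and> even j \<and> even k then 1 else 0 :: rat)" for i j k :: nat
  define ooo where "ooo i j k = (if odd i \<and> odd j \<and> odd k then 1 else 0 :: rat)" for i j k :: nat
  define eee where "eee i j k = (if even i \<and> even j \<and> even k then 1 else 0 :: rat)" for i j k :: nat
  define X0 where "X0 = (\<Sum>(i, j, k)\<in>R. ooo i j k * ?r i j k)"
  define X1 where "X1 = (\<Sum>(i, j, k)\<in>R. oee i j k * ?r i j k)"
  have N0: "N > 0"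
    using N(3) by (cases "N = 0") auto
  have rot: "(j, k, i) \<in> R" if "(i, j, k) \<in> R" for i j k
    using that unfolding R_def by (rule residue_triples_rotate)
  have R: "sum_triples N Q = R"
    by (simp only: R_def residue_triples_1)
  have R_sum: "i + j + k = N" "i < N" "j < N" "k < N" "\<not> p dvd i" "\<not> p dvd j" "\<not> p dvd k"
    if "(i, j, k) \<in> R" for i j k
    using that coprime_pos_not_dvd[OF _ Q(1)]
    by (auto simp: R_def residue_triples_def sum_triples_def)
  have R_parity: "odd (i + j + k)" if "(i, j, k) \<in> R" for i j k
    using R_sum(1)[OF that] N(3) by simp

  \<comment> \<open>As \<open>N\<close> is odd, either all three entries are odd or exactly one is;
    the rotations of \<open>oee\<close> tell which.\<close>
  have "harmonic_sum N Q = (\<Sum>(i, j, k)\<in>R. ooo i j k * ?r i j k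
      + (oee i j k * ?r i j k + oee j k i * ?r j k i + oee k i j * ?r k i j))"
    unfolding harmonic_sum_def R
    by (intro sum.cong refl, clarify, drule R_parity)
      (auto simp: ooo_def oee_def recip3_rotate split: if_splits)
  also have "\<dots> = X0 + (\<Sum>(i, j, k)\<in>R. oee i j k * ?r i j k + oee j k i * ?r j k i + oee k i j * ?r k i j)"
    by (simp only: X0_def split_def sum.distrib)
  also have "(\<Sum>(i, j, k)\<in>R. oee i j k * ?r i j k + oee j k i * ?r j k i + oee k i j * ?r k i j) = 3 * X1"
    unfolding X1_def by (rule sum_cyclic[OF rot])
  finally have Z: "harmonic_sum N Q = X0 + 3 * X1" .

  \<comment> \<open>The sign is negative when all entries are odd. Among triples with one odd entry
    it is negative only if that entry is \<open>i\<close>, hence the subtraction of twice the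
    \<open>oee\<close> term.\<close>
  have "(\<Sum>(i, j, k)\<in>sum_triples N Q. (- 1) ^ i * ?r i j k)
    = (\<Sum>(i, j, k)\<in>R. - (ooo i j k * ?r i j k)
      + ((oee i j k * ?r i j k + oee j k i * ?r j k i + oee k i j * ?r k i j)
        - 2 * (oee i j k * ?r i j k)))"
    unfolding R
    by (intro sum.cong refl, clarify, drule R_parity)
      (auto simp: ooo_def oee_def recip3_rotate split: if_splits)
  also have "\<dots> = - X0 + ((\<Sum>(i, j, k)\<in>R. oee i j k * ?r i j k + oee j k i * ?r j k i + oee k i j * ?r k i j)
      - 2 * X1)"
    by (simp only: X0_def X1_def split_def sum.distrib sum_negf sum_subtractf sum_distrib_left)
  also have "(\<Sum>(i, j, k)\<in>R. oee i j k * ?r i j k + oee j k i * ?r j k i + oee k i j * ?r k i j) = 3 * X1"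
    unfolding X1_def by (rule sum_cyclic[OF rot])
  finally have T: "(\<Sum>(i, j, k)\<in>sum_triples N Q. (- 1) ^ i * ?r i j k) = - X0 + X1"
    by simp

  have odd_Q: "odd Q"
    using Q(2) N(3) by (meson dvd_trans)
  \<comment> \<open>Doubling all entries maps onto the all-even triples with sum
    \<open>2 * N\<close>, because \<open>Q\<close> is odd. Each reciprocal product shrinks by the
    factor 8.\<close>
  have half: "harmonic_sum N Q = 8 * (\<Sum>(i, j, k)\<in>sum_triples (2 * N) Q. eee i j k * ?r i j k)"
  proof -
    have "(\<Sum>(i, j, k)\<in>sum_triples (2 * N) Q. eee i j k * ?r i j k)
      = (\<Sum>(i, j, k)\<in>{(i, j, k) \<in> sum_triples (2 * N) Q. even i \<and> even j \<and> even k}. ?r i j k)"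
      by (rule sum.mono_neutral_cong_right)
        (auto simp: eee_def split: if_splits intro: finite_subset[OF _ finite_sum_triples[of "2 * N" Q]])
    also have "\<dots> = (\<Sum>(i, j, k)\<in>sum_triples N Q. ?r (2 * i) (2 * j) (2 * k))"
      by (rule sum.reindex_bij_witness[of _ "\<lambda>(i, j, k). (2 * i, 2 * j, 2 * k)"
            "\<lambda>(i, j, k). (i div 2, j div 2, k div 2)"])
        (use odd_Q in \<open>auto simp: sum_triples_def coprime_pos_def elim!: evenE\<close>)
    finally show ?thesis
      by (simp add: harmonic_sum_def recip3_def sum_distrib_left split_def mult_ac)
  qed

  \<comment> \<open>The relation between \<open>X0\<close> and \<open>X1\<close> comes with a factor 3, so for \<open>p = 3\<close> it is needed
    modulo one further power of \<open>p\<close>.\<close>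
  define e :: nat where "e = (if p = 3 then 1 else 0)"
  have three: "3 \<in> pideal e"
    using pideal_of_nat_power[of 1] by (auto simp: e_def)
  have e1: "e \<le> 1"
    by (simp add: e_def)
  have cancel3: "x \<in> pideal a" if "3 * x \<in> pideal (a + e)" for x
  proof (cases "p = 3")
    case True
    then show ?thesis
      using that pideal_cancel_power[of 1 x a] by (simp add: e_def)
  next
    case False
    then have "\<not> p dvd 3"
      using dvd_imp_le[of p 3] p_gt_2 by auto
    then show ?thesis
      using that pideal_cancel[of 3 x a] False by (simp add: e_def)
  qed

  \<comment> \<open>For period \<open>N\<close> and \<open>m = 2\<close>: with carry 1 one copy of
    \<open>N\<close> remains to be added to one of the three entries, with carry 2 none.\<close>
  have s1: "simplex 2 (Suc 0) = {(1, 0, 0), (0, 1, 0), (0, 0, 1)}"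
    by (auto simp: simplex_def)
  have s2: "simplex 2 2 = {(0, 0, 0)}"
    by (auto simp: simplex_def)
  have "Q \<noteq> 1"
    using Q(1) prime_p by auto
  then have "(\<Sum>(i, j, k)\<in>sum_triples (2 * N) Q. eee i j k * ?r i j k)
    = (\<Sum>(i, j, k)\<in>R. eee (i + N) j k * ?r (i + N) j k
        + (eee i (j + N) k * ?r i (j + N) k + eee i j (k + N) * ?r i j (k + N)))
      + (\<Sum>(i, j, k)\<in>residue_triples N Q 2. eee i j k * ?r i j k)"
    by (subst sum_triples_period[OF Q(2) _ N0]) (simp_all add: s1 s2 R_def)
  \<comment> \<open>Adding the odd number \<open>N\<close> flips the parity of one entry, so "all
    even" becomes "only that entry odd" for the remainders.\<close>
  also have "(\<Sum>(i, j, k)\<in>R. eee (i + N) j k * ?r (i + N) j k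
        + (eee i (j + N) k * ?r i (j + N) k + eee i j (k + N) * ?r i j (k + N)))
     = (\<Sum>(i, j, k)\<in>R. oee i j k * ?r (i + N) j k
        + oee j k i * ?r (j + N) k i + oee k i j * ?r (k + N) i j)"
    by (intro sum.cong refl, clarify) (use N(3) in \<open>auto simp: eee_def oee_def recip3_def mult_ac\<close>)
  also have "\<dots> = 3 * (\<Sum>(i, j, k)\<in>R. oee i j k * ?r (i + N) j k)"
    by (rule sum_cyclic[OF rot])
  \<comment> \<open>Reflection in the odd number \<open>N\<close> flips all parities: even
    remainders with sum \<open>2 * N\<close> become odd ones with sum \<open>N\<close>.\<close>
  also have "(\<Sum>(i, j, k)\<in>residue_triples N Q 2. eee i j k * ?r i j k)
      = (\<Sum>(i, j, k)\<in>O3. ?r (N - i) (N - j) (N - k))"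
  proof -
    have "(\<Sum>(i, j, k)\<in>residue_triples N Q 2. eee i j k * ?r i j k)
      = (\<Sum>(i, j, k)\<in>R. eee (N - i) (N - j) (N - k) * ?r (N - i) (N - j) (N - k))"
      unfolding R_def by (rule sum_residue_triples_reflect[OF Q(2)])
    also have "\<dots> = (\<Sum>(i, j, k)\<in>R. ooo i j k * ?r (N - i) (N - j) (N - k))"
    proof (intro sum.cong refl, clarify)
      fix i j k assume "(i, j, k) \<in> R"
      then have "eee (N - i) (N - j) (N - k) = ooo i j k"
        using R_sum(2-4)[of i j k] N(3) by (simp add: eee_def ooo_def)
      then show "eee (N - i) (N - j) (N - k) * ?r (N - i) (N - j) (N - k)
          = ooo i j k * ?r (N - i) (N - j) (N - k)"
        by (simp only:)
    qed
    also have "\<dots> = (\<Sum>(i, j, k)\<in>O3. ?r (N - i) (N - j) (N - k))"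
      by (rule sum.mono_neutral_cong_right)
        (auto simp: R_def O3_def ooo_def split: if_splits)
    finally show ?thesis .
  qed
  finally have E: "harmonic_sum N Q = 8 * (3 * (\<Sum>(i, j, k)\<in>R. oee i j k * ?r (i + N) j k)
      + (\<Sum>(i, j, k)\<in>O3. ?r (N - i) (N - j) (N - k)))"
    unfolding half by simp

  \<comment> \<open>Replacing \<open>i + N\<close> by \<open>i\<close> is valid modulo
    \<open>p ^ a\<close>; the factor 3, an element of \<open>pideal e\<close>, lifts this to
    \<open>p ^ (a + e)\<close>.\<close>
  have "rat_cong p (a + e) (3 * (\<Sum>(i, j, k)\<in>R. oee i j k * ?r (i + N) j k)) (3 * X1)"
  proof (rule rat_cong_scale_pideal[OF _ three], unfold X1_def, rule rat_cong_sum, clarify)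
    fix i j k assume ijk: "(i, j, k) \<in> R"
    have nd: "\<not> p dvd i" "\<not> p dvd j" "\<not> p dvd k"
      using R_sum[OF ijk] by auto
    have "rat_cong p a (of_nat (i + N)) (of_nat i)"
      using N(1) by (intro rat_cong_of_nat) (auto simp: cong_def mod_add_right_eq)
    moreover have "\<not> p dvd i + N"
      using nd(1) Q by (meson dvd_add_left_iff dvd_trans)
    ultimately have "rat_cong p a (1 / of_nat (i + N)) (1 / of_nat i)"
      using nd(1) by (intro rat_cong_inverse)
    then have "rat_cong p a (?r (i + N) j k) (?r i j k)"
      unfolding recip3_mult using nd unit_of_nat unit_of_nat[OF \<open>\<not> p dvd i + N\<close>]
      by (intro rat_cong_mult rat_cong_refl pideal_mult0) auto
    then show "rat_cong p a (oee i j k * ?r (i + N) j k) (oee i j k * ?r i j k)"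
      by (auto simp: oee_def)
  qed
  moreover have "rat_cong p (a + e) (\<Sum>(i, j, k)\<in>O3. ?r (N - i) (N - j) (N - k)) (- X0)"
  proof -
    have "X0 = (\<Sum>(i, j, k)\<in>O3. ?r i j k)"
      unfolding X0_def by (rule sum.mono_neutral_cong_right) (auto simp: R_def O3_def ooo_def split: if_splits)
    moreover have "O3 \<subseteq> residue_triples N Q 1"
      by (auto simp: O3_def R_def)
    moreover have "(j, k, i) \<in> O3" if "(i, j, k) \<in> O3" for i j k
      using that rot by (auto simp: O3_def)
    ultimately show ?thesis
      using sum_recip3_reflect[of O3 N Q 1, OF _ _ N(1,2) Q(1) _ three] e1 N(2) by simp
  qed
  ultimately have "rat_cong p (a + e) (harmonic_sum N Q) (8 * (3 * X1 + - X0))"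
    unfolding E by (rule rat_cong_scale[OF rat_cong_add]) simp
  \<comment> \<open>\<open>X0 + 3 * X1\<close> minus \<open>8 * (3 * X1 - X0)\<close> equals
    \<open>9 * X0 - 21 * X1\<close>.\<close>
  then have "3 * (3 * X0 - 7 * X1) \<in> pideal (a + e)"
    by (simp add: rat_cong_iff Z algebra_simps)
  then have "3 * X0 - 7 * X1 \<in> pideal a"
    by (rule cancel3)
  moreover have "\<not> p dvd 2 ^ 2"
    using dvd_imp_le[of p 2] p_gt_2 prime_dvd_power[OF prime_p, of 2 2] by linarith
  \<comment> \<open>Division by -4 gives exactly \<open>X1 - X0\<close> plus a quarter of
    \<open>X0 + 3 * X1\<close>, the difference of the two sides.\<close>
  ultimately have "- ((3 * X0 - 7 * X1) / of_nat (2 ^ 2)) \<in> pideal a"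
    by (intro pideal_minus pideal_divide_of_nat)
  moreover have "- ((3 * X0 - 7 * X1) / of_nat (2 ^ 2)) = - X0 + X1 - - (1 / 4) * (X0 + 3 * X1)"
    by (simp add: field_simps)
  ultimately show ?thesis
    unfolding T Z rat_cong_iff by (simp only:)
qed

end

section \<open>Power sums and Bernoulli numbers\<close>

text \<open>Induction on \<open>n\<close>: the right side increases by
  \<open>(k + 1) * n ^ k\<close>. This follows by expanding the powers of \<open>n + 1\<close>,
  exchanging the two sums and applying the Bernoulli recurrence to each coefficient.\<close>

lemma faulhaber:
  "of_nat (k + 1) * (\<Sum>s<n. of_nat s ^ k) =
     (\<Sum>i\<le>k. of_nat ((k + 1) choose i) * bernoulli i * of_nat n ^ (k + 1 - i))"
proof (induction n)
  case 0
  show ?case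
    by (simp add: power_0_left)
next
  case (Suc n)
  define b where "b i = of_nat ((k + 1) choose i) * bernoulli i" for i
  define N :: rat where "N = of_nat n"
  have pw: "(N + 1) ^ m = N ^ m + (\<Sum>l<m. of_nat (m choose l) * N ^ l)" for m
    using binomial_ring[of N 1 m] by (simp add: lessThan_Suc_atMost [symmetric])
  \<comment> \<open>Both sides count the ordered pairs of disjoint subsets of sizes \<open>i\<close>
    and \<open>l\<close> in a set of \<open>k + 1\<close> elements.\<close>
  have coeff: "of_nat ((k + 1) choose i) * of_nat ((k + 1 - i) choose l)
      = (of_nat ((k + 1) choose l) * of_nat ((k + 1 - l) choose i) :: rat)" if "i + l \<le> k" for i l
  proof -
    have "((k + 1) choose i) * ((k + 1 - i) choose l) = ((k + 1) choose l) * ((k + 1 - l) choose i)"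
      using choose_mult[of i "i + l" "k + 1"] choose_mult[of l "i + l" "k + 1"] that
        binomial_symmetric[of i "i + l"] by simp
    then show ?thesis
      by (simp only: flip: of_nat_mult)
  qed
  \<comment> \<open>The case \<open>m = 0\<close> is \<open>bernoulli 0 = 1\<close>. Applied with
    \<open>m = k - l\<close>, this leaves only the term \<open>l = k\<close>.\<close>
  have inner: "(\<Sum>i\<le>m. of_nat ((m + 1) choose i) * bernoulli i) = (if m = 0 then 1 else 0)" for m
    using bernoulli_recurrence[of m] by (auto simp: atMost_atLeast0)
  have "(\<Sum>i\<le>k. b i * (N + 1) ^ (k + 1 - i)) - (\<Sum>i\<le>k. b i * N ^ (k + 1 - i))
      = (\<Sum>i\<le>k. \<Sum>l<k + 1 - i. b i * (of_nat ((k + 1 - i) choose l) * N ^ l))"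
    by (simp add: pw distrib_left sum.distrib sum_distrib_left)
  also have "\<dots> = (\<Sum>i\<le>k. \<Sum>l | l \<in> {..k} \<and> i + l \<le> k. b i * (of_nat ((k + 1 - i) choose l) * N ^ l))"
    by (intro sum.cong refl) auto
  also have "\<dots> = (\<Sum>l\<le>k. \<Sum>i | i \<in> {..k} \<and> i + l \<le> k. b i * (of_nat ((k + 1 - i) choose l) * N ^ l))"
    by (rule sum.swap_restrict) auto
  also have "\<dots> = (\<Sum>l\<le>k. \<Sum>i\<le>k - l. b i * (of_nat ((k + 1 - i) choose l) * N ^ l))"
    by (intro sum.cong refl) auto
  also have "\<dots> = (\<Sum>l\<le>k. \<Sum>i\<le>k - l.
      (of_nat ((k + 1) choose l) * N ^ l) * (of_nat ((k - l + 1) choose i) * bernoulli i))"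
  proof (intro sum.cong refl)
    fix l i assume "l \<in> {..k}" "i \<in> {..k - l}"
    then have il: "i + l \<le> k" "k - l + 1 = k + 1 - l"
      by auto
    have "b i * (of_nat ((k + 1 - i) choose l) * N ^ l)
      = (of_nat ((k + 1) choose i) * of_nat ((k + 1 - i) choose l)) * bernoulli i * N ^ l"
      by (simp only: b_def mult_ac)
    also have "\<dots> = (of_nat ((k + 1) choose l) * N ^ l) * (of_nat ((k - l + 1) choose i) * bernoulli i)"
      by (simp only: coeff[OF il(1)] il(2) mult_ac)
    finally show "b i * (of_nat ((k + 1 - i) choose l) * N ^ l)
      = (of_nat ((k + 1) choose l) * N ^ l) * (of_nat ((k - l + 1) choose i) * bernoulli i)" .
  qed
  also have "\<dots> = (\<Sum>l\<le>k. (of_nat ((k + 1) choose l) * N ^ l) * (if l = k then 1 else 0))"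
    by (simp only: sum_distrib_left[symmetric] inner) (auto intro!: sum.cong)
  also have "\<dots> = of_nat (k + 1) * N ^ k"
    by (simp add: if_distrib cong: if_cong)
  finally have "(\<Sum>i\<le>k. b i * (N + 1) ^ (k + 1 - i))
      = (\<Sum>i\<le>k. b i * N ^ (k + 1 - i)) + of_nat (k + 1) * N ^ k"
    by (simp only: diff_eq_eq add.commute)
  moreover have "of_nat (k + 1) * (\<Sum>s<n. of_nat s ^ k) = (\<Sum>i\<le>k. b i * N ^ (k + 1 - i))"
    using Suc.IH by (simp only: b_def N_def)
  moreover have "of_nat (Suc n) = N + 1"
    by (simp add: N_def)
  ultimately show ?case
    by (simp only: b_def sum.lessThan_Suc distrib_left N_def)
qed

section \<open>Power sums modulo \<open>p\<close> and \<open>p ^ 2\<close>\<close>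

context odd_prime
begin

text \<open>The recursion for \<open>bernoulli n\<close> divides only by \<open>n + 1\<close>, which
  is below \<open>p\<close>.\<close>

lemma bernoulli_pideal0: "n + 1 < p \<Longrightarrow> bernoulli n \<in> pideal 0"
proof (induction n rule: less_induct)
  case (less n)
  show ?case
  proof (cases n)
    case (Suc m)
    have "(\<Sum>i\<le>m. of_nat (Suc (Suc m) choose i) * bernoulli i) \<in> pideal 0"
      using less Suc by (intro pideal_sum pideal_mult0) auto
    moreover have "\<not> p dvd Suc (Suc m)"
      using less.prems Suc by (auto dest: dvd_imp_le)
    ultimately show ?thesis
      unfolding Suc bernoulli.simps minus_divide_left[symmetric]
      by (intro pideal_minus pideal_divide_of_nat)
  qed simp
qed

text \<open>In Faulhaber's formula at \<open>n = p\<close> the term \<open>i = k\<close> is the main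
  one and all others contain \<open>p ^ 2\<close>. The bound on \<open>k\<close> makes
  \<open>k + 1\<close> a unit and the Bernoulli numbers integral.\<close>

lemma sum_powers_p2:
  assumes "k + 2 \<le> p"
  shows "rat_cong p 2 (\<Sum>s<p. of_nat s ^ k) (of_nat p * bernoulli k)"
proof -
  have "of_nat (k + 1) * (\<Sum>s<p. of_nat s ^ k)
      = (\<Sum>i<k. of_nat ((k + 1) choose i) * bernoulli i * of_nat p ^ (k + 1 - i))
        + of_nat (k + 1) * (of_nat p * bernoulli k)"
    unfolding faulhaber lessThan_Suc_atMost[symmetric] by simp
  moreover have "(\<Sum>i<k. of_nat ((k + 1) choose i) * bernoulli i * of_nat p ^ (k + 1 - i)) \<in> pideal 2"
    using assms
    by (intro pideal_sum pideal_mult0 bernoulli_pideal0 pideal_0_of_nat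
        pideal_mono[OF pideal_of_nat_power]) auto
  ultimately have "of_nat (k + 1) * ((\<Sum>s<p. of_nat s ^ k) - of_nat p * bernoulli k) \<in> pideal 2"
    by (simp add: right_diff_distrib)
  moreover have "\<not> p dvd k + 1"
    using assms by (auto dest: dvd_imp_le)
  ultimately show ?thesis
    unfolding rat_cong_iff by (rule pideal_cancel)
qed

lemma rat_cong_p [simp]: "rat_cong p (Suc 0) (of_nat p) 0"
  using pideal_of_nat[of 1 p] by (simp add: rat_cong_iff)

lemma sum_powers_small:
  assumes "k + 2 \<le> p"
  shows "rat_cong p 1 (\<Sum>s<p. of_nat s ^ k) 0"
proof -
  have "rat_cong p 1 (\<Sum>s<p. of_nat s ^ k) (of_nat p * bernoulli k)"
    using sum_powers_p2[OF assms] by (rule rat_cong_mono) simp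
  also have "rat_cong p 1 (of_nat p * bernoulli k) (0 * bernoulli k)"
    using assms by (intro rat_cong_mult bernoulli_pideal0) auto
  finally show ?thesis
    by simp
qed

lemma fermat_rat: "\<not> p dvd s \<Longrightarrow> rat_cong p 1 (of_nat s ^ (p - 1)) 1"
  using rat_cong_of_nat[of "s ^ (p - 1)" 1 1] fermat_theorem[OF prime_p] by simp

lemma p_dvd_rat_cong_0: "p dvd s \<Longrightarrow> rat_cong p 1 (of_nat s) 0"
  using pideal_of_nat[of 1 s] by (simp add: rat_cong_iff)

lemma rat_cong_power: "rat_cong p a x y \<Longrightarrow> x \<in> pideal 0 \<Longrightarrow> y \<in> pideal 0 \<Longrightarrow> rat_cong p a (x ^ n) (y ^ n)"
  by (induction n) (auto intro!: rat_cong_mult pideal_power0)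

text \<open>Fermat's theorem trades reciprocal powers for ordinary ones, to which Faulhaber's
  formula applies.\<close>

lemma power_inverse_cong:
  assumes "\<not> p dvd s" "n + m = p - 1"
  shows "rat_cong p 1 (of_nat s ^ n) (1 / of_nat s ^ m)"
proof -
  have "rat_cong p 1 (of_nat s ^ (p - 1) * (1 / of_nat s) ^ m) (1 * (1 / of_nat s) ^ m)"
    using unit_of_nat[OF assms(1)] by (intro rat_cong_mult fermat_rat assms pideal_power0) auto
  moreover have "of_nat s ^ (p - 1) * (1 / of_nat s) ^ m = (of_nat s ^ n :: rat)"
    using unit_of_nat[OF assms(1)]
    by (simp only: assms(2)[symmetric] power_add) (simp add: field_simps)
  ultimately show ?thesis
    by (simp add: power_divide)
qed

text \<open>In this range \<open>p - 1\<close> is the only multiple of \<open>p - 1\<close>.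
  Exponents from \<open>p\<close> on are lowered by \<open>p - 1\<close> with Fermat's theorem,
  which leaves a positive exponent of the small case.\<close>

lemma sum_powers:
  assumes k: "0 < k" "k \<le> 2 * p - 4"
  shows "rat_cong p 1 (\<Sum>s<p. of_nat s ^ k) (if k = p - 1 then - 1 else 0)"
proof -
  consider "k + 2 \<le> p" | "k = p - 1" | "k \<ge> p"
    by linarith
  then show ?thesis
  proof cases
    case 1
    then show ?thesis
      using sum_powers_small[of k] by auto
  next
    case 2
    have "(\<Sum>s<p. of_nat s ^ k) = (\<Sum>s\<in>{1..<p}. of_nat s ^ k :: rat)"
      using k by (intro sum.mono_neutral_right) (auto simp: power_0_left)
    also have "rat_cong p 1 \<dots> (\<Sum>s\<in>{1..<p}. 1)"
      unfolding 2 by (intro rat_cong_sum fermat_rat) (auto dest: dvd_imp_le)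
    also have "(\<Sum>s\<in>{1..<p}. 1) = of_nat p - (1 :: rat)"
      using p_gt_0 by (simp add: of_nat_diff)
    also have "rat_cong p 1 \<dots> (0 - 1)"
      by (intro rat_cong_diff) auto
    finally show ?thesis
      using 2 by simp
  next
    case 3
    define l where "l = k - (p - 1)"
    have l: "k = (p - 1) + l" "l > 0" "l + 2 \<le> p"
      using 3 k p_gt_2 by (auto simp: l_def)
    have "rat_cong p 1 (\<Sum>s<p. of_nat s ^ k) (\<Sum>s<p. of_nat s ^ l)"
    proof (rule rat_cong_sum)
      fix s assume s: "s \<in> {..<p}"
      show "rat_cong p 1 (of_nat s ^ k) (of_nat s ^ l)"
      proof (cases "s = 0")
        case False
        then have "\<not> p dvd s"
          using s by (auto dest: dvd_imp_le)
        then have "rat_cong p 1 (of_nat s ^ (p - 1) * of_nat s ^ l) (1 * of_nat s ^ l)"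
          by (intro rat_cong_mult fermat_rat pideal_power0) auto
        then show ?thesis
          by (simp add: l(1) power_add)
      qed (use l p_gt_2 in \<open>auto simp: power_0_left\<close>)
    qed
    also have "rat_cong p 1 \<dots> 0"
      by (rule sum_powers_small[OF l(3)])
    finally show ?thesis
      using 3 p_gt_0 by auto
  qed
qed

lemma unit_below_p: "s \<in> {1..<p} \<Longrightarrow> \<not> p dvd s"
  by (auto dest: dvd_imp_le)

lemma not_dvd_mult: "\<not> p dvd c \<Longrightarrow> \<not> p dvd s \<Longrightarrow> \<not> p dvd c * s"
  using prime_p by (simp add: prime_dvd_mult_iff)

text \<open>The power \<open>p - 2\<close> also absorbs the side condition, since multiples of
  \<open>p\<close> contribute 0 modulo \<open>p\<close>.\<close>

lemma harmonic_cong_powers: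
  "rat_cong p 1 (\<Sum>j | j < n \<and> \<not> p dvd j. 1 / of_nat j) (\<Sum>j<n. of_nat j ^ (p - 2))"
proof -
  have "(\<Sum>j | j < n \<and> \<not> p dvd j. 1 / of_nat j) = (\<Sum>j<n. if p dvd j then 0 else 1 / of_nat j :: rat)"
    by (rule sum.mono_neutral_cong_left) auto
  also have "rat_cong p 1 \<dots> (\<Sum>j<n. of_nat j ^ (p - 2))"
  proof (rule rat_cong_sum)
    fix j
    show "rat_cong p 1 (if p dvd j then 0 else 1 / of_nat j) (of_nat j ^ (p - 2))"
    proof (cases "p dvd j")
      case True
      then have "rat_cong p 1 (of_nat j ^ (p - 2)) (0 ^ (p - 2))"
        by (intro rat_cong_power p_dvd_rat_cong_0) auto
      then show ?thesis
        using True p_gt_2 by (auto simp: power_0_left intro: rat_cong_sym)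
    next
      case False
      then show ?thesis
        using power_inverse_cong[of j "p - 2" 1] p_gt_2 by (auto intro: rat_cong_sym)
    qed
  qed
  finally show ?thesis .
qed

text \<open>Fermat turns the reciprocals into powers, and Faulhaber's formula at
  \<open>c * s\<close> leaves power sums of \<open>s\<close> with exponents
  \<open>2 * p - 4 - i\<close> for \<open>i \<le> p - 2\<close>. Only \<open>i = p - 3\<close> gives
  exponent \<open>p - 1\<close> and survives, with coefficient \<open>c ^ (p - 1)\<close>, so the
  result does not depend on \<open>c\<close>.\<close>

lemma harmonic_double_sum:
  assumes c: "\<not> p dvd c"
  shows "rat_cong p 1
    (\<Sum>s\<in>{1..<p}. 1 / of_nat (c * s) ^ 2 * (\<Sum>j | j < c * s \<and> \<not> p dvd j. 1 / of_nat j))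
    (bernoulli (p - 3))"
proof -
  let ?C = "(p - 1) choose (p - 3)"
  define b where "b i = of_nat ((p - 1) choose i) * bernoulli i" for i
  define L :: rat where "L = (\<Sum>s\<in>{1..<p}. of_nat (c * s) ^ (p - 3) * (\<Sum>j<c * s. of_nat j ^ (p - 2)))"
  have L_cong: "rat_cong p 1
    (\<Sum>s\<in>{1..<p}. 1 / of_nat (c * s) ^ 2 * (\<Sum>j | j < c * s \<and> \<not> p dvd j. 1 / of_nat j)) L"
    unfolding L_def
  proof (rule rat_cong_sum, rule rat_cong_mult)
    fix s assume "s \<in> {1..<p}"
    then have cs: "\<not> p dvd c * s"
      by (intro not_dvd_mult c unit_below_p)
    show "rat_cong p 1 (1 / of_nat (c * s) ^ 2) (of_nat (c * s) ^ (p - 3))"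
      using cs p_gt_2 by (intro rat_cong_sym[OF power_inverse_cong]) auto
    show "1 / of_nat (c * s) ^ 2 \<in> pideal 0"
      using pideal_power0[of "1 / of_nat (c * s)" 2] unit_of_nat[OF cs] by (simp add: power_divide)
    show "(\<Sum>j<c * s. of_nat j ^ (p - 2)) \<in> pideal 0"
      by (intro pideal_sum pideal_power0) auto
  qed (rule harmonic_cong_powers)
  have L2: "rat_cong p 1 (of_nat (p - 1) * L) (- of_nat ?C * bernoulli (p - 3))"
  proof -
    \<comment> \<open>The term \<open>s = 0\<close> may be added because its inner sum is empty,
      also for \<open>p = 3\<close>, where \<open>0 ^ (p - 3)\<close> is 1.\<close>
    have "of_nat (p - 1) * L = (\<Sum>s<p. of_nat (c * s) ^ (p - 3) *
        (of_nat (p - 2 + 1) * (\<Sum>j<c * s. of_nat j ^ (p - 2))))"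
      unfolding L_def sum_distrib_left using p_gt_2
      by (intro sum.mono_neutral_cong_left) (auto simp: mult_ac not_le)
    also have "\<dots> = (\<Sum>s<p. \<Sum>i\<le>p - 2. b i * of_nat c ^ (2 * p - 4 - i) * of_nat s ^ (2 * p - 4 - i))"
      unfolding faulhaber unfolding sum_distrib_left
    proof (intro sum.cong refl)
      fix s i assume "i \<in> {..p - 2}"
      then have "2 * p - 4 - i = p - 3 + (p - 1 - i)" "p - 2 + 1 = p - 1"
        using p_gt_2 by auto
      then show "of_nat (c * s) ^ (p - 3) * (of_nat ((p - 2 + 1) choose i) * bernoulli i *
          of_nat (c * s) ^ (p - 2 + 1 - i))
        = b i * of_nat c ^ (2 * p - 4 - i) * of_nat s ^ (2 * p - 4 - i)"
        by (simp only: b_def of_nat_mult power_mult_distrib power_add mult_ac)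
    qed
    also have "\<dots> = (\<Sum>i\<le>p - 2. b i * of_nat c ^ (2 * p - 4 - i) * (\<Sum>s<p. of_nat s ^ (2 * p - 4 - i)))"
      unfolding sum_distrib_left by (rule sum.swap)
    finally have L_eq: "of_nat (p - 1) * L
      = (\<Sum>i\<le>p - 2. b i * of_nat c ^ (2 * p - 4 - i) * (\<Sum>s<p. of_nat s ^ (2 * p - 4 - i)))" .
    have "rat_cong p 1 (of_nat (p - 1) * L)
      (\<Sum>i\<le>p - 2. b i * of_nat c ^ (2 * p - 4 - i) * (if i = p - 3 then - 1 else 0))"
      unfolding L_eq
    proof (rule rat_cong_sum)
      fix i assume "i \<in> {..p - 2}"
      then have i: "0 < 2 * p - 4 - i" "2 * p - 4 - i \<le> 2 * p - 4"
        "2 * p - 4 - i = p - 1 \<longleftrightarrow> i = p - 3" "i + 1 < p"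
        using p_gt_2 by auto
      have "rat_cong p 1 (\<Sum>s<p. of_nat s ^ (2 * p - 4 - i)) (if i = p - 3 then - 1 else 0)"
        using sum_powers[OF i(1,2)] by (simp only: i(3))
      then show "rat_cong p 1 (b i * of_nat c ^ (2 * p - 4 - i) * (\<Sum>s<p. of_nat s ^ (2 * p - 4 - i)))
          (b i * of_nat c ^ (2 * p - 4 - i) * (if i = p - 3 then - 1 else 0))"
        unfolding b_def by (rule rat_cong_scale) (intro pideal_mult0 pideal_power0 bernoulli_pideal0 i, auto)
    qed
    also have "(\<Sum>i\<le>p - 2. b i * of_nat c ^ (2 * p - 4 - i) * (if i = p - 3 then - 1 else 0))
      = (\<Sum>i\<le>p - 2. if i = p - 3 then - b (p - 3) * of_nat c ^ (p - 1) else 0)"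
    proof (intro sum.cong refl)
      fix i
      have "2 * p - 4 - (p - 3) = p - 1"
        using p_gt_2 by simp
      then show "b i * of_nat c ^ (2 * p - 4 - i) * (if i = p - 3 then - 1 else 0)
        = (if i = p - 3 then - b (p - 3) * of_nat c ^ (p - 1) else 0)"
        by (cases "i = p - 3") (simp_all only: if_True if_False refl simp_thms
          mult_minus_right mult_1_right mult_minus_left mult_zero_right)
    qed
    also have "\<dots> = - b (p - 3) * of_nat c ^ (p - 1)"
      using p_gt_2 by (subst sum.delta) auto
    also have "rat_cong p 1 (- b (p - 3) * of_nat c ^ (p - 1)) (- b (p - 3) * 1)"
      unfolding b_def
      by (intro rat_cong_scale fermat_rat c pideal_minus pideal_mult0 bernoulli_pideal0)
        (use p_gt_2 in auto)
    finally show ?thesis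
      by (simp add: b_def)
  qed
  have "rat_cong p 1 L (bernoulli (p - 3))"
  proof -
    \<comment> \<open>The binomial coefficient is \<open>(p - 1) * (p - 2) / 2\<close>, so
      \<open>p - 1\<close> cancels against the Faulhaber factor, and the remaining
      \<open>- (p - 2) / 2\<close> is congruent to 1.\<close>
    have "?C = (p - 1) choose 2"
      using binomial_symmetric[of 2 "p - 1"] p_gt_2 by (simp add: numeral_2_eq_2 numeral_3_eq_3)
    moreover have "p - 1 - 1 = p - 2"
      by arith
    ultimately have "?C = (p - 1) * (p - 2) div 2"
      using choose_two[of "p - 1"] by (simp only:)
    moreover have "even ((p - 1) * (p - 2))"
      using odd_p by simp
    ultimately have C: "2 * ?C = (p - 1) * (p - 2)"
      by (simp only: dvd_mult_div_cancel)
    define B where "B = bernoulli (p - 3)"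
    have C': "2 * of_nat ?C = (of_nat (p - 1) * (of_nat p - 2) :: rat)"
      using arg_cong[OF C, of "of_nat :: nat \<Rightarrow> rat"] p_gt_2 by (simp add: of_nat_diff)
    have "2 * (of_nat (p - 1) * L - - of_nat ?C * B) \<in> pideal 1"
      using L2 by (intro pideal_mult0) (auto simp: rat_cong_iff B_def)
    also have "2 * (of_nat (p - 1) * L - - of_nat ?C * B)
        = of_nat (p - 1) * (2 * L) + (2 * of_nat ?C) * B"
      by (simp add: algebra_simps)
    also have "\<dots> = of_nat (p - 1) * (2 * L + (of_nat p - 2) * B)"
      unfolding C' by (simp add: algebra_simps)
    finally have "2 * L + (of_nat p - 2) * B \<in> pideal 1"
      by (rule pideal_cancel) (use p_gt_2 unit_below_p[of "p - 1"] in auto)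
    moreover have "of_nat p * B \<in> pideal 1"
      unfolding B_def using pideal_of_nat[of 1 p] p_gt_2 by (intro pideal_mult0' bernoulli_pideal0) auto
    ultimately have "2 * L + (of_nat p - 2) * B - of_nat p * B \<in> pideal 1"
      by (rule pideal_diff)
    then have "of_nat 2 * (L - B) \<in> pideal 1"
      by (simp add: algebra_simps)
    then have "L - B \<in> pideal 1"
      by (rule pideal_cancel) (use p_gt_2 unit_below_p[of 2] in auto)
    then show ?thesis
      by (simp only: rat_cong_iff B_def)
  qed
  with L_cong show ?thesis
    by (rule rat_cong_trans)
qed

section \<open>Voronoi's congruence\<close>

text \<open>The binomial theorem to first order. For \<open>k = 0\<close> the truncated exponent
  \<open>k - 1\<close> is harmless, as its coefficient is 0.\<close>

lemma power_add_cong: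
  assumes "y \<in> pideal 0" "x \<in> pideal 1"
  shows "rat_cong p 2 ((y + x) ^ k) (y ^ k + of_nat k * x * y ^ (k - 1))"
proof (induction k)
  case (Suc k)
  have x0: "x \<in> pideal 0"
    using assms(2) by (rule pideal_mono) simp
  have "rat_cong p 2 ((y + x) * (y + x) ^ k) ((y + x) * (y ^ k + of_nat k * x * y ^ (k - 1)))"
    using Suc.IH assms(1) x0 by (intro rat_cong_scale pideal_add)
  also have "rat_cong p 2 \<dots> (y ^ Suc k + of_nat (Suc k) * x * y ^ k)"
  proof -
    have "x * x * (of_nat k * y ^ (k - 1)) \<in> pideal (1 + 1)"
      using assms by (intro pideal_mult pideal_mult0' pideal_mult0 pideal_power0) auto
    moreover have "(y + x) * (y ^ k + of_nat k * x * y ^ (k - 1)) - (y ^ Suc k + of_nat (Suc k) * x * y ^ k)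
      = x * x * (of_nat k * y ^ (k - 1))"
      by (cases k) (simp_all add: algebra_simps)
    ultimately show ?thesis
      by (simp add: rat_cong_iff numeral_2_eq_2)
  qed
  finally show ?case
    by simp
qed simp

lemma bij_betw_mult_mod:
  assumes "\<not> p dvd c"
  shows "bij_betw (\<lambda>s. c * s mod p) {1..<p} {1..<p}"
proof -
  have "inj_on (\<lambda>s. c * s mod p) {1..<p}"
  proof (rule inj_onI)
    fix s t assume st: "s \<in> {1..<p}" "t \<in> {1..<p}" "c * s mod p = c * t mod p"
    have "coprime c p"
      using prime_imp_coprime[OF prime_p assms] by (simp add: coprime_commute)
    then have "[s = t] (mod p)"
      using st(3) by (simp add: cong_def cong_mult_lcancel_nat[unfolded cong_def])
    then show "s = t"
      using st by (simp add: cong_def)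
  qed
  moreover have "(\<lambda>s. c * s mod p) ` {1..<p} \<subseteq> {1..<p}"
  proof clarify
    fix s assume "s \<in> {1..<p}"
    then have "\<not> p dvd c * s"
      by (intro not_dvd_mult assms unit_below_p)
    then show "c * s mod p \<in> {1..<p}"
      using p_gt_0 by (auto simp: dvd_eq_mod_eq_0 Suc_le_eq)
  qed
  ultimately show ?thesis
    by (simp add: bij_betw_def endo_inj_surj)
qed

text \<open>Voronoi's congruence for index \<open>k = p - 3\<close>: the sum of \<open>s ^ k\<close>
  modulo \<open>p ^ 2\<close> is unchanged when \<open>s\<close> is replaced by
  \<open>c * s mod p\<close>. By Fermat \<open>c ^ k\<close> becomes \<open>1 / c ^ 2\<close> and
  \<open>(c * s) ^ (k - 1)\<close> becomes \<open>1 / (c * s) ^ 3\<close>, while \<open>k\<close> is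
  congruent to -3.\<close>

lemma voronoi:
  assumes c: "\<not> p dvd c"
  shows "rat_cong p 1
    (3 * (\<Sum>s\<in>{1..<p}. of_nat (c * s div p) * (1 / of_nat (c * s) ^ 3)))
    ((1 - 1 / of_nat c ^ 2) * bernoulli (p - 3))"
proof (cases "p = 3")
  \<comment> \<open>For \<open>p = 3\<close> both sides vanish: the left has the factor 3, and
    \<open>c ^ 2\<close> is 1 modulo 3.\<close>
  case True
  have inv: "1 / of_nat n ^ m \<in> pideal 0" if "\<not> p dvd n" for n m
    using pideal_power0[of "1 / of_nat n" m] unit_of_nat[OF that] by (simp add: power_divide)
  have "3 \<in> pideal 1"
    using pideal_of_nat[of 1 3] True by simp
  then have "3 * (\<Sum>s\<in>{1..<p}. of_nat (c * s div p) * (1 / of_nat (c * s) ^ 3)) \<in> pideal 1"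
    by (intro pideal_mult0' pideal_sum pideal_mult0 inv not_dvd_mult c unit_below_p) auto
  moreover have "rat_cong p 1 (1 / of_nat c ^ 2) 1"
    using rat_cong_sym[OF power_inverse_cong[OF c, of 0 2]] True by simp
  then have "1 - 1 / of_nat c ^ 2 \<in> pideal 1"
    using rat_cong_sym by (simp add: rat_cong_iff)
  then have "(1 - 1 / of_nat c ^ 2) * bernoulli (p - 3) \<in> pideal 1"
    using p_gt_2 by (intro pideal_mult0' bernoulli_pideal0) auto
  ultimately show ?thesis
    unfolding rat_cong_iff by (rule pideal_diff)
next
  case False
  define k where "k = p - 3"
  \<comment> \<open>Hence \<open>p\<close> is at least 5, and \<open>k - 1\<close> is a genuine
    subtraction.\<close>
  have "p \<noteq> 4"
    using odd_p by auto
  then have k: "k + 3 = p" "k \<ge> 2"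
    using False p_gt_2 by (auto simp: k_def)
  define P where "P = (\<Sum>s\<in>{1..<p}. of_nat s ^ k :: rat)"
  define W where "W = (\<Sum>s\<in>{1..<p}. of_nat (c * s div p) * of_nat (c * s) ^ (k - 1) :: rat)"
  have P: "rat_cong p 2 P (of_nat p * bernoulli k)"
  proof -
    have "P = (\<Sum>s<p. of_nat s ^ k)"
      unfolding P_def using k by (intro sum.mono_neutral_left) (auto simp: not_le power_0_left)
    then show ?thesis
      using sum_powers_p2[of k] k by simp
  qed
  have "P = (\<Sum>s\<in>{1..<p}. of_nat (c * s mod p) ^ k)"
    unfolding P_def by (rule sum.reindex_bij_betw[OF bij_betw_mult_mod[OF c], symmetric])
  also have "rat_cong p 2 \<dots> (\<Sum>s\<in>{1..<p}. of_nat (c * s) ^ k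
      + of_nat k * - (of_nat p * of_nat (c * s div p)) * of_nat (c * s) ^ (k - 1))"
  proof (rule rat_cong_sum)
    fix s
    have "of_nat (c * s) = (of_nat (c * s div p * p + c * s mod p) :: rat)"
      by (simp only: div_mult_mod_eq)
    then have "of_nat (c * s mod p) = (of_nat (c * s) + - (of_nat p * of_nat (c * s div p)) :: rat)"
      by (simp only: of_nat_add of_nat_mult) (simp add: mult_ac)
    moreover have "of_nat p * of_nat (c * s div p) \<in> pideal 1"
      using pideal_of_nat[of 1 p] by (intro pideal_mult0') auto
    ultimately show "rat_cong p 2 (of_nat (c * s mod p) ^ k) (of_nat (c * s) ^ k
      + of_nat k * - (of_nat p * of_nat (c * s div p)) * of_nat (c * s) ^ (k - 1))"
      by (simp only:) (intro power_add_cong pideal_minus pideal_0_of_nat)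
  qed
  also have "(\<Sum>s\<in>{1..<p}. of_nat (c * s) ^ k
      + of_nat k * - (of_nat p * of_nat (c * s div p)) * of_nat (c * s) ^ (k - 1))
    = of_nat c ^ k * P - of_nat p * (of_nat k * W)"
    by (simp add: P_def W_def sum_distrib_left sum_subtractf power_mult_distrib mult_ac)
  finally have "P - (of_nat c ^ k * P - of_nat p * (of_nat k * W)) \<in> pideal 2"
    by (simp only: rat_cong_iff)
  \<comment> \<open>Adding this multiple of the congruence for \<open>P\<close> replaces
    \<open>P\<close> by \<open>p * bernoulli k\<close>; afterwards everything has the factor
    \<open>p\<close>, which is cancelled.\<close>
  moreover have "(of_nat c ^ k - 1) * (P - of_nat p * bernoulli k) \<in> pideal 2"
    using P unfolding rat_cong_iff
    by (intro pideal_mult0[of "of_nat c ^ k - 1"] pideal_diff[of "of_nat c ^ k"] pideal_power0) auto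
  ultimately have mem: "P - (of_nat c ^ k * P - of_nat p * (of_nat k * W))
      + (of_nat c ^ k - 1) * (P - of_nat p * bernoulli k) \<in> pideal 2"
    by (rule pideal_add)
  have eq: "P - (of_nat c ^ k * P - of_nat p * (of_nat k * W))
      + (of_nat c ^ k - 1) * (P - of_nat p * bernoulli k)
    = of_nat p ^ 1 * (of_nat k * W - (of_nat c ^ k - 1) * bernoulli k)"
    by (simp add: algebra_simps)
  have "of_nat k * W - (of_nat c ^ k - 1) * bernoulli k \<in> pideal 1"
    by (rule pideal_cancel_power[of 1]) (use mem in \<open>simp only: eq one_add_one\<close>)
  then have "rat_cong p 1 (of_nat k * W) ((of_nat c ^ k - 1) * bernoulli k)"
    by (simp only: rat_cong_iff)
  also have "rat_cong p 1 ((of_nat c ^ k - 1) * bernoulli k) ((1 / of_nat c ^ 2 - 1) * bernoulli k)"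
    using k
    by (intro rat_cong_mult[of 1 "of_nat c ^ k - 1"] rat_cong_diff[of 1 "of_nat c ^ k"]
        power_inverse_cong c pideal_diff[of "of_nat c ^ k"] pideal_power0 bernoulli_pideal0) auto
  finally have 1: "rat_cong p 1 (of_nat k * W) ((1 / of_nat c ^ 2 - 1) * bernoulli k)" .
  define V where "V = (\<Sum>s\<in>{1..<p}. of_nat (c * s div p) * (1 / of_nat (c * s) ^ 3) :: rat)"
  have W0: "W \<in> pideal 0"
    unfolding W_def by (intro pideal_sum pideal_mult0 pideal_power0 pideal_0_of_nat)
  have "rat_cong p 1 W V"
    unfolding W_def V_def
  proof (rule rat_cong_sum, rule rat_cong_scale)
    fix s assume "s \<in> {1..<p}"
    then show "rat_cong p 1 (of_nat (c * s) ^ (k - 1)) (1 / of_nat (c * s) ^ 3)"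
      using k by (intro power_inverse_cong not_dvd_mult c unit_below_p) auto
  qed auto
  then have "rat_cong p 1 (3 * V) (3 * W)"
    by (intro rat_cong_scale rat_cong_sym[of _ W]) auto
  also have "rat_cong p 1 \<dots> (- (of_nat k * W))"
  \<comment> \<open>Uses \<open>k + 3 = p\<close>, so that \<open>3 * W\<close> and
    \<open>- (k * W)\<close> differ by \<open>p * W\<close>.\<close>
  proof -
    have "of_nat p * W \<in> pideal 1"
      using pideal_of_nat[of 1 p] W0 by (intro pideal_mult0') auto
    moreover have "3 * W - - (of_nat k * W) = of_nat p * W"
      by (simp add: algebra_simps flip: k(1))
    ultimately show ?thesis
      by (simp only: rat_cong_iff)
  qed
  also have "rat_cong p 1 \<dots> (- ((1 / of_nat c ^ 2 - 1) * bernoulli k))"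
    by (rule rat_cong_minus[OF 1])
  also have "- ((1 / of_nat c ^ 2 - 1) * bernoulli k) = (1 - 1 / of_nat c ^ 2) * bernoulli k"
    by (simp add: algebra_simps)
  finally show ?thesis
    by (simp only: V_def k_def)
qed

section \<open>Reciprocal pairs with a given sum\<close>

text \<open>The differences \<open>n - j\<close> run through the positive multiples of
  \<open>p\<close> up to \<open>n\<close>. The inverse uses \<open>t + 1\<close> because
  \<open>t\<close> counts from 0.\<close>

lemma card_multiples_shifted: "card {j. j < n \<and> p dvd n - j} = n div p"
proof -
  have "card {j. j < n \<and> p dvd n - j} = card {..<n div p}"
  proof (rule bij_betw_same_card[OF bij_betwI[of _ _ _ "\<lambda>t. n - p * (t + 1)"]])
    show "(\<lambda>j. (n - j) div p - 1) \<in> {j. j < n \<and> p dvd n - j} \<rightarrow> {..<n div p}"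
    proof
      fix j assume "j \<in> {j. j < n \<and> p dvd n - j}"
      then have "j < n" "p dvd n - j"
        by auto
      then have "0 < (n - j) div p"
        using p_gt_0 by (auto simp: div_greater_zero_iff dest: dvd_imp_le)
      moreover have "(n - j) div p \<le> n div p"
        by (simp add: div_le_mono)
      ultimately show "(n - j) div p - 1 \<in> {..<n div p}"
        by auto
    qed
    show "(\<lambda>t. n - p * (t + 1)) \<in> {..<n div p} \<rightarrow> {j. j < n \<and> p dvd n - j}"
    proof
      fix t assume "t \<in> {..<n div p}"
      then have "p * (t + 1) \<le> p * (n div p)"
        by (intro mult_le_mono2) auto
      also have "\<dots> \<le> n"
        by simp
      finally have le: "p * (t + 1) \<le> n" .
      moreover have "0 < p * (t + 1)"
        using p_gt_0 by simp
      ultimately have "n - p * (t + 1) < n" "n - (n - p * (t + 1)) = p * (t + 1)"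
        by linarith+
      then show "n - p * (t + 1) \<in> {j. j < n \<and> p dvd n - j}"
        by simp
    qed
    show "n - p * ((n - j) div p - 1 + 1) = j" if "j \<in> {j. j < n \<and> p dvd n - j}" for j
    proof -
      have j: "j < n" "p dvd n - j"
        using that by auto
      then have "0 < (n - j) div p"
        using p_gt_0 by (auto simp: div_greater_zero_iff dest: dvd_imp_le)
      then have "(n - j) div p - 1 + 1 = (n - j) div p"
        by simp
      then show ?thesis
        using j by simp
    qed
    show "(n - (n - p * (t + 1))) div p - 1 = t" if "t \<in> {..<n div p}" for t
    proof -
      have "p * (t + 1) \<le> p * (n div p)"
        using that by (intro mult_le_mono2) auto
      also have "\<dots> \<le> n"
        by simp
      finally have "n - (n - p * (t + 1)) = p * (t + 1)"
        by simp
      then show ?thesis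
        using p_gt_0 by simp
    qed
  qed
  then show ?thesis
    by simp
qed

text \<open>Partial fractions and the symmetry of \<open>j\<close> and \<open>n - j\<close> give
  twice a harmonic sum divided by \<open>n\<close>. The excluded \<open>j\<close> with
  \<open>p dvd n - j\<close> are congruent to \<open>n\<close>, so each costs \<open>1 / n\<close>,
  and there are \<open>n div p\<close> of them.\<close>

lemma pair_sum:
  assumes n: "\<not> p dvd n"
  shows "rat_cong p 1
    (\<Sum>j | j < n \<and> \<not> p dvd j \<and> \<not> p dvd n - j. 1 / (of_nat j * of_nat (n - j)))
    (2 / of_nat n * ((\<Sum>j | j < n \<and> \<not> p dvd j. 1 / of_nat j) - of_nat (n div p) / of_nat n))"
proof -
  let ?J = "{j. j < n \<and> \<not> p dvd j \<and> \<not> p dvd n - j}"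
  have n0: "of_nat n \<noteq> (0 :: rat)" "1 / of_nat n \<in> pideal 0"
    using unit_of_nat[OF n] by auto
  have "(\<Sum>j\<in>?J. 1 / (of_nat j * of_nat (n - j)))
    = (\<Sum>j\<in>?J. 1 / of_nat n * (1 / of_nat j + 1 / of_nat (n - j)) :: rat)"
  proof (rule sum.cong)
    fix j assume j: "j \<in> ?J"
    then have "j > 0"
      by (auto intro: Nat.gr0I)
    then show "1 / (of_nat j * of_nat (n - j)) = (1 / of_nat n * (1 / of_nat j + 1 / of_nat (n - j)) :: rat)"
      using j n0 by (simp add: of_nat_diff field_simps)
  qed simp
  also have "\<dots> = 1 / of_nat n * ((\<Sum>j\<in>?J. 1 / of_nat j) + (\<Sum>j\<in>?J. 1 / of_nat (n - j)))"
    by (simp only: sum_distrib_left[symmetric] sum.distrib)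
  also have "(\<Sum>j\<in>?J. 1 / of_nat (n - j)) = (\<Sum>j\<in>?J. 1 / of_nat j :: rat)"
    by (rule sum.reindex_bij_witness[of _ "\<lambda>j. n - j" "\<lambda>j. n - j"])
      (auto intro!: diff_less Nat.gr0I)
  also have "(\<Sum>j\<in>?J. 1 / of_nat j :: rat)
      = (\<Sum>j | j < n \<and> \<not> p dvd j. 1 / of_nat j) - (\<Sum>j | j < n \<and> p dvd n - j. 1 / of_nat j)"
  proof -
    \<comment> \<open>As \<open>p\<close> does not divide \<open>n\<close>, the two exclusions never
      overlap.\<close>
    have "\<not> p dvd j" if "j < n" "p dvd n - j" for j
      using that n by (metis dvd_diffD less_imp_le)
    then have "{j. j < n \<and> \<not> p dvd j} = ?J \<union> {j. j < n \<and> p dvd n - j}"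
      by auto
    moreover have "(\<Sum>j\<in>?J \<union> {j. j < n \<and> p dvd n - j}. 1 / of_nat j :: rat)
        = (\<Sum>j\<in>?J. 1 / of_nat j) + (\<Sum>j | j < n \<and> p dvd n - j. 1 / of_nat j)"
      by (rule sum.union_disjoint) auto
    ultimately show ?thesis
      by simp
  qed
  finally have eq: "(\<Sum>j\<in>?J. 1 / (of_nat j * of_nat (n - j))) = 2 * (1 / of_nat n) *
    ((\<Sum>j | j < n \<and> \<not> p dvd j. 1 / of_nat j) - (\<Sum>j | j < n \<and> p dvd n - j. 1 / of_nat j) :: rat)"
    by simp
  have "rat_cong p 1 (\<Sum>j | j < n \<and> p dvd n - j. 1 / of_nat j) (of_nat (n div p) / of_nat n)"
  proof -
    have "rat_cong p 1 (\<Sum>j | j < n \<and> p dvd n - j. 1 / of_nat j)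
        (\<Sum>j | j < n \<and> p dvd n - j. 1 / of_nat n)"
    proof (rule rat_cong_sum)
      fix j assume "j \<in> {j. j < n \<and> p dvd n - j}"
      then have j: "j < n" "p dvd n - j"
        by auto
      then have "\<not> p dvd j"
        using n by (metis dvd_diffD less_imp_le)
      moreover have "rat_cong p 1 (of_nat n) (of_nat j)"
        using pideal_of_nat[of 1 "n - j"] j by (simp add: rat_cong_iff of_nat_diff)
      ultimately show "rat_cong p 1 (1 / of_nat j) (1 / of_nat n)"
        using n by (intro rat_cong_inverse rat_cong_sym[of _ "of_nat n"])
    qed
    also have "(\<Sum>j | j < n \<and> p dvd n - j. 1 / of_nat n) = (of_nat (n div p) / of_nat n :: rat)"
      by (simp add: card_multiples_shifted)
    finally show ?thesis .
  qed
  then have "rat_cong p 1 (2 * (1 / of_nat n) *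
      ((\<Sum>j | j < n \<and> \<not> p dvd j. 1 / of_nat j) - (\<Sum>j | j < n \<and> p dvd n - j. 1 / of_nat j)))
    (2 * (1 / of_nat n) * ((\<Sum>j | j < n \<and> \<not> p dvd j. 1 / of_nat j) - of_nat (n div p) / of_nat n))"
    using n0 by (intro rat_cong_scale rat_cong_diff rat_cong_refl pideal_mult0 pideal_0_numeral)
  then show ?thesis
    unfolding eq by simp
qed

lemma coprime_pos_p: "i \<in> coprime_pos p \<longleftrightarrow> \<not> p dvd i"
  using prime_p prime_imp_coprime[OF prime_p, of i]
  by (auto simp: coprime_pos_def coprime_commute intro: Nat.gr0I dest: coprime_common_divisor)

section \<open>The sum for the product of two primes\<close>

text \<open>With \<open>i = c * (p - s)\<close> the other two entries add up to
  \<open>c * s\<close>, which is the situation of \<open>pair_sum\<close>. Since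
  \<open>1 / i\<close> is congruent to \<open>- 1 / (c * s)\<close>, the harmonic part becomes the
  double sum and the quotients \<open>c * s div p\<close> become Voronoi's sum.\<close>

lemma sum_multiples_triples:
  assumes c: "\<not> p dvd c"
  shows "rat_cong p 1
    (\<Sum>(i, j, k)\<in>{(i, j, k) \<in> sum_triples (c * p) p. c dvd i}.
       recip3 (of_nat i) (of_nat j) (of_nat k))
    (- 2 * bernoulli (p - 3)
       + 2 * (\<Sum>s\<in>{1..<p}. of_nat (c * s div p) * (1 / of_nat (c * s) ^ 3)))"
proof -
  have c0: "c > 0"
    using c by (auto intro: Nat.gr0I)
  define J where "J n = {j. j < n \<and> \<not> p dvd j \<and> \<not> p dvd n - j}" for n
  define H :: "nat \<Rightarrow> rat" where "H n = (\<Sum>j | j < n \<and> \<not> p dvd j. 1 / of_nat j)" for n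
  define V where "V = (\<Sum>s\<in>{1..<p}. of_nat (c * s div p) * (1 / of_nat (c * s) ^ 3) :: rat)"
  have fin: "finite (J n)" for n
    by (simp add: J_def)
  have H0: "H n \<in> pideal 0" for n
    unfolding H_def by (intro pideal_sum) (auto simp: unit_of_nat)
  have "(\<Sum>(i, j, k)\<in>{(i, j, k) \<in> sum_triples (c * p) p. c dvd i}.
       recip3 (of_nat i) (of_nat j) (of_nat k))
     = (\<Sum>(s, j)\<in>Sigma {1..<p} (\<lambda>s. J (c * s)).
         recip3 (of_nat (c * (p - s))) (of_nat j) (of_nat (c * s - j)))"
  proof (rule sum.reindex_bij_witness[of _ "\<lambda>(s, j). (c * (p - s), j, c * s - j)"
        "\<lambda>(i, j, k). (p - i div c, j)"])
    fix x assume "x \<in> {(i, j, k) \<in> sum_triples (c * p) p. c dvd i}"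
    then obtain i j k where x: "x = (c * i, j, k)" and sum: "c * i + j + k = c * p"
      and nd: "\<not> p dvd c * i" "\<not> p dvd j" "\<not> p dvd k"
      by (auto simp: sum_triples_def coprime_pos_p elim!: dvdE)
    have "i > 0" "j > 0" "k > 0"
      using nd by (auto intro: Nat.gr0I)
    then have "c * i < c * p"
      using sum by linarith
    then have "i < p"
      by simp
    have jk: "c * (p - i) = j + k"
      using sum \<open>i < p\<close> by (simp add: diff_mult_distrib2)
    show "(case case x of (i, j, k) \<Rightarrow> (p - i div c, j) of (s, j) \<Rightarrow> (c * (p - s), j, c * s - j)) = x"
      using c0 jk \<open>i < p\<close> by (simp add: x)
    show "(case x of (i, j, k) \<Rightarrow> (p - i div c, j)) \<in> Sigma {1..<p} (\<lambda>s. J (c * s))"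
      using c0 jk \<open>i < p\<close> \<open>i > 0\<close> \<open>k > 0\<close> nd by (simp add: x J_def)
    show "(case case x of (i, j, k) \<Rightarrow> (p - i div c, j) of (s, j) \<Rightarrow>
          recip3 (of_nat (c * (p - s))) (of_nat j) (of_nat (c * s - j)))
        = (case x of (i, j, k) \<Rightarrow> recip3 (of_nat i) (of_nat j) (of_nat k))"
      using c0 jk \<open>i < p\<close> by (simp add: x)
  next
    fix y assume "y \<in> Sigma {1..<p} (\<lambda>s. J (c * s))"
    then obtain s j where y: "y = (s, j)" and s: "0 < s" "s < p" and j: "j < c * s"
      "\<not> p dvd j" "\<not> p dvd c * s - j"
      by (auto simp: J_def)
    show "(case case y of (s, j) \<Rightarrow> (c * (p - s), j, c * s - j) of (i, j, k) \<Rightarrow> (p - i div c, j)) = y"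
      using c0 s by (simp add: y)
    have "c * (p - s) + c * s = c * p"
      using s by (simp flip: distrib_left)
    then have "c * (p - s) + j + (c * s - j) = c * p"
      using j(1) by linarith
    moreover have "\<not> p dvd c * (p - s)"
      using s by (intro not_dvd_mult c unit_below_p) auto
    ultimately show "(case y of (s, j) \<Rightarrow> (c * (p - s), j, c * s - j))
        \<in> {(i, j, k) \<in> sum_triples (c * p) p. c dvd i}"
      using j by (simp add: y sum_triples_def coprime_pos_p)
  qed
  also have "\<dots> = (\<Sum>s\<in>{1..<p}. \<Sum>j\<in>J (c * s).
      recip3 (of_nat (c * (p - s))) (of_nat j) (of_nat (c * s - j)))"
    by (rule sum.Sigma[symmetric]) (auto simp: fin)
  also have "\<dots> = (\<Sum>s\<in>{1..<p}. 1 / of_nat (c * (p - s)) *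
      (\<Sum>j\<in>J (c * s). 1 / (of_nat j * of_nat (c * s - j))))"
    by (simp add: recip3_def sum_distrib_left mult.assoc)
  finally have eq: "(\<Sum>(i, j, k)\<in>{(i, j, k) \<in> sum_triples (c * p) p. c dvd i}.
       recip3 (of_nat i) (of_nat j) (of_nat k))
     = (\<Sum>s\<in>{1..<p}. 1 / of_nat (c * (p - s)) *
      (\<Sum>j\<in>J (c * s). 1 / (of_nat j * of_nat (c * s - j))))" .
  have "rat_cong p 1 (\<Sum>s\<in>{1..<p}. 1 / of_nat (c * (p - s)) *
      (\<Sum>j\<in>J (c * s). 1 / (of_nat j * of_nat (c * s - j))))
    (\<Sum>s\<in>{1..<p}. - (1 / of_nat (c * s)) *
      (2 / of_nat (c * s) * (H (c * s) - of_nat (c * s div p) / of_nat (c * s))))"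
  proof (rule rat_cong_sum)
    fix s assume s: "s \<in> {1..<p}"
    have "p - s \<in> {1..<p}"
      using s by auto
    then have nd: "\<not> p dvd c * s" "\<not> p dvd c * (p - s)"
      using not_dvd_mult[OF c unit_below_p[OF s]] not_dvd_mult[OF c unit_below_p] by blast+
    have u: "1 / of_nat (c * s) \<in> pideal 0" "of_nat (c * s) \<noteq> (0 :: rat)"
        "1 / of_nat (c * (p - s)) \<in> pideal 0" "of_nat (c * (p - s)) \<noteq> (0 :: rat)"
      using unit_of_nat[OF nd(1)] unit_of_nat[OF nd(2)] by blast+
    \<comment> \<open>The two denominators add up to \<open>c * p\<close>.\<close>
    have "1 / of_nat (c * (p - s)) - - (1 / of_nat (c * s))
      = of_nat c * of_nat p * (1 / of_nat (c * (p - s))) * (1 / of_nat (c * s) :: rat)"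
      using u(2,4) s by (simp add: of_nat_diff field_simps)
    moreover have "of_nat c * of_nat p * (1 / of_nat (c * (p - s))) * (1 / of_nat (c * s)) \<in> pideal 1"
      using pideal_of_nat[of 1 p]
      by (intro pideal_mult0' u pideal_mult0[OF pideal_0_of_nat]) auto
    ultimately have 1: "rat_cong p 1 (1 / of_nat (c * (p - s))) (- (1 / of_nat (c * s)))"
      by (simp only: rat_cong_iff)
    have 2: "2 / of_nat (c * s) * (H (c * s) - of_nat (c * s div p) / of_nat (c * s)) \<in> pideal 0"
    proof -
      have "2 * (1 / of_nat (c * s)) * (H (c * s) - of_nat (c * s div p) * (1 / of_nat (c * s))) \<in> pideal 0"
        by (intro pideal_mult0 pideal_diff H0 u pideal_0_numeral pideal_0_of_nat)
      then show ?thesis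
        by simp
    qed
    show "rat_cong p 1
      (1 / of_nat (c * (p - s)) * (\<Sum>j\<in>J (c * s). 1 / (of_nat j * of_nat (c * s - j))))
      (- (1 / of_nat (c * s)) *
        (2 / of_nat (c * s) * (H (c * s) - of_nat (c * s div p) / of_nat (c * s))))"
      unfolding J_def H_def
      by (intro rat_cong_mult 1 pair_sum[OF nd(1)] u(3) 2[unfolded H_def])
  qed
  also have "(\<Sum>s\<in>{1..<p}. - (1 / of_nat (c * s)) *
      (2 / of_nat (c * s) * (H (c * s) - of_nat (c * s div p) / of_nat (c * s))))
    = - 2 * (\<Sum>s\<in>{1..<p}. 1 / of_nat (c * s) ^ 2 * H (c * s)) + 2 * V"
    unfolding V_def sum_distrib_left sum.distrib[symmetric]
    by (intro sum.cong refl) (simp add: power2_eq_square power3_eq_cube right_diff_distrib)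
  also have "rat_cong p 1 \<dots> (- 2 * bernoulli (p - 3) + 2 * V)"
    unfolding H_def
    by (intro rat_cong_add rat_cong_scale rat_cong_refl harmonic_double_sum c pideal_minus) simp
  finally show ?thesis
    by (simp only: V_def eq)
qed

text \<open>The case \<open>c = 1\<close>: every triple qualifies, and all quotients
  \<open>s div p\<close> vanish.\<close>

lemma harmonic_sum_p: "rat_cong p 1 (harmonic_sum p p) (- 2 * bernoulli (p - 3))"
proof -
  have "(\<Sum>s\<in>{1..<p}. of_nat (1 * s div p) * (1 / of_nat (1 * s) ^ 3)) = (0 :: rat)"
    by (intro sum.neutral) auto
  moreover have "\<not> p dvd 1"
    using prime_p by auto
  ultimately show ?thesis
    using sum_multiples_triples[of 1] by (simp add: harmonic_sum_def)
qed

section \<open>Inclusion-exclusion over the multiples of \<open>q\<close>\<close>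

text \<open>The sum of the entries is divisible by \<open>q\<close>, so 0, 1 or 3 of them are, never
  exactly 2. The weight \<open>1 - (d i + d j + d k) + 2 * d i * d j * d k\<close> therefore is 1 in
  the first case and 0 in the other two.\<close>

lemma harmonic_sum_pq_eq:
  assumes q: "prime q" "p \<noteq> q"
  defines "A \<equiv> (\<Sum>(i, j, k)\<in>{(i, j, k) \<in> sum_triples (q * p) p. q dvd i}.
    recip3 (of_nat i) (of_nat j) (of_nat k))"
  shows "harmonic_sum (q * p) (p * q) =
    harmonic_sum (q * p) p - 3 * A + 2 * (1 / of_nat q ^ 3) * harmonic_sum p p"
proof -
  let ?r = "\<lambda>i j k. recip3 (of_nat i) (of_nat j) (of_nat k)"
  let ?T = "sum_triples (q * p) p"
  define d :: "nat \<Rightarrow> rat" where "d i = (if q dvd i then 1 else 0)" for i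
  have cpq: "i \<in> coprime_pos (p * q) \<longleftrightarrow> i \<in> coprime_pos p \<and> \<not> q dvd i" for i
    using q(1) prime_imp_coprime[OF q(1), of i]
    by (auto simp: coprime_pos_def coprime_commute dest: coprime_common_divisor)
  have "harmonic_sum (q * p) (p * q) = (\<Sum>(i, j, k)\<in>?T.
      ?r i j k - (d i * ?r i j k + d j * ?r j k i + d k * ?r k i j) + 2 * (d i * d j * d k * ?r i j k))"
    unfolding harmonic_sum_def
  proof (rule sum.mono_neutral_cong_left, safe)
    fix i j k
    assume "(i, j, k) \<in> sum_triples (q * p) (p * q)"
    then have "(i, j, k) \<in> ?T \<and> \<not> q dvd i \<and> \<not> q dvd j \<and> \<not> q dvd k"
      by (auto simp: sum_triples_def cpq)
    then show "(i, j, k) \<in> ?T" "?r i j k = ?r i j k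
        - (d i * ?r i j k + d j * ?r j k i + d k * ?r k i j) + 2 * (d i * d j * d k * ?r i j k)"
      by (auto simp: d_def)
  next
    fix i j k
    assume T: "(i, j, k) \<in> ?T" "(i, j, k) \<notin> sum_triples (q * p) (p * q)"
    then have "i + j + k = q * p"
      by (auto simp: sum_triples_def)
    then have "q dvd i + j + k"
      by simp
    then have "q dvd i \<Longrightarrow> q dvd j \<longleftrightarrow> q dvd k" "q dvd j \<Longrightarrow> q dvd i \<longleftrightarrow> q dvd k"
        "q dvd k \<Longrightarrow> q dvd i \<longleftrightarrow> q dvd j"
      by (metis dvd_add_right_iff dvd_add_left_iff add.assoc add.commute)+
    moreover have "q dvd i \<or> q dvd j \<or> q dvd k"
      using T by (auto simp: sum_triples_def cpq)
    ultimately consider "q dvd i" "q dvd j" "q dvd k" | "q dvd i" "\<not> q dvd j" "\<not> q dvd k"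
      | "\<not> q dvd i" "q dvd j" "\<not> q dvd k" | "\<not> q dvd i" "\<not> q dvd j" "q dvd k"
      by blast
    moreover have "?r j k i = ?r i j k" "?r k i j = ?r i j k"
      by (simp_all add: recip3_def mult_ac)
    ultimately show "?r i j k
        - (d i * ?r i j k + d j * ?r j k i + d k * ?r k i j) + 2 * (d i * d j * d k * ?r i j k) = 0"
      by cases (simp_all add: d_def)
  qed simp
  also have "(\<Sum>(i, j, k)\<in>?T.
      ?r i j k - (d i * ?r i j k + d j * ?r j k i + d k * ?r k i j) + 2 * (d i * d j * d k * ?r i j k))
    = harmonic_sum (q * p) p
      - (\<Sum>(i, j, k)\<in>?T. d i * ?r i j k + d j * ?r j k i + d k * ?r k i j)
      + 2 * (\<Sum>(i, j, k)\<in>?T. d i * d j * d k * ?r i j k)"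
    by (simp only: harmonic_sum_def split_def sum.distrib sum_subtractf sum_distrib_left)
  also have "(\<Sum>(i, j, k)\<in>?T. d i * ?r i j k + d j * ?r j k i + d k * ?r k i j)
      = 3 * (\<Sum>(i, j, k)\<in>?T. d i * ?r i j k)"
    by (rule sum_cyclic[OF sum_triples_rotate])
  also have "(\<Sum>(i, j, k)\<in>?T. d i * ?r i j k) = A"
    unfolding A_def by (rule sum.mono_neutral_cong_right) (auto simp: d_def split: if_splits)
  also have "(\<Sum>(i, j, k)\<in>?T. d i * d j * d k * ?r i j k)
      = (\<Sum>(i, j, k)\<in>{(i, j, k) \<in> ?T. q dvd i \<and> q dvd j \<and> q dvd k}. ?r i j k)"
    by (rule sum.mono_neutral_cong_right) (auto simp: d_def split: if_splits)
  \<comment> \<open>Dividing all three entries by \<open>q\<close> leaves triples with sum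
    \<open>p\<close>, which accounts for the factor \<open>1 / q ^ 3\<close>.\<close>
  also have "\<dots> = (\<Sum>(i, j, k)\<in>sum_triples p p. ?r (q * i) (q * j) (q * k))"
  proof -
    have "\<not> p dvd q"
      using q prime_p primes_dvd_imp_eq by blast
    then have q0: "q > 0" and pq: "p dvd q * i \<longleftrightarrow> p dvd i" for i
      using prime_p by (auto simp: prime_dvd_mult_iff intro: Nat.gr0I)
    have img: "(q * i, q * j, q * k) \<in> ?T \<longleftrightarrow> (i, j, k) \<in> sum_triples p p" for i j k
    proof -
      have "q * i + q * j + q * k = q * p \<longleftrightarrow> i + j + k = p"
        using q0 by (simp flip: distrib_left)
      then show ?thesis
        by (simp add: sum_triples_def coprime_pos_p pq)
    qed
    show ?thesis
    proof (rule sum.reindex_bij_witness[of _ "\<lambda>(i, j, k). (q * i, q * j, q * k)"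
          "\<lambda>(i, j, k). (i div q, j div q, k div q)"])
      fix x assume "x \<in> {(i, j, k) \<in> ?T. q dvd i \<and> q dvd j \<and> q dvd k}"
      then obtain i j k where x: "x = (q * i, q * j, q * k)" and T: "x \<in> ?T"
        by (auto elim!: dvdE)
      show "(case x of (i, j, k) \<Rightarrow> (i div q, j div q, k div q)) \<in> sum_triples p p"
        using T q0 by (simp add: x img)
      show "(case case x of (i, j, k) \<Rightarrow> (i div q, j div q, k div q) of (i, j, k) \<Rightarrow>
          ?r (q * i) (q * j) (q * k)) = (case x of (i, j, k) \<Rightarrow> ?r i j k)"
        using q0 by (simp add: x)
    qed (use q0 img in auto)
  qed
  also have "\<dots> = 1 / of_nat q ^ 3 * harmonic_sum p p"
    unfolding harmonic_sum_def sum_distrib_left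
    by (intro sum.cong refl) (auto simp: recip3_def power3_eq_cube)
  finally show ?thesis
    by simp
qed

lemma harmonic_sum_pq:
  assumes q: "prime q" "p \<noteq> q"
  shows "rat_cong p 1 (harmonic_sum (q * p) (p * q))
    (- 2 * (of_nat q - 2) * (1 - 1 / of_nat q ^ 3) * bernoulli (p - 3))"
proof -
  define B where "B = bernoulli (p - 3)"
  define A where "A = (\<Sum>(i, j, k)\<in>{(i, j, k) \<in> sum_triples (q * p) p. q dvd i}.
    recip3 (of_nat i) (of_nat j) (of_nat k))"
  define V where "V = (\<Sum>s\<in>{1..<p}. of_nat (q * s div p) * (1 / of_nat (q * s) ^ 3) :: rat)"
  have nd: "\<not> p dvd q"
    using q prime_p primes_dvd_imp_eq by blast
  have q3: "1 / of_nat q ^ 3 \<in> pideal 0"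
    using pideal_power0[of "1 / of_nat q" 3] unit_of_nat[OF nd] by (simp add: power_divide)
  have 1: "rat_cong p 1 (harmonic_sum (q * p) p) (of_nat q * (- 2 * B))"
  proof -
    \<comment> \<open>Periodicity with period \<open>p\<close> and multiplier \<open>q\<close>,
      where \<open>e = 0\<close>.\<close>
    have "rat_cong p (1 + 0) (harmonic_sum (q * p) p) (of_nat q * harmonic_sum p p)"
      using p_gt_0 by (intro harmonic_sum_period) auto
    also have "rat_cong p (1 + 0) \<dots> (of_nat q * (- 2 * B))"
      unfolding B_def using harmonic_sum_p by (intro rat_cong_scale) auto
    finally show ?thesis
      by simp
  qed
  \<comment> \<open>The factor 3 stays in place because Voronoi's congruence determines
    \<open>3 * V\<close>.\<close>
  have "rat_cong p 1 (3 * A) (3 * (- 2 * B + 2 * V))"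
    unfolding A_def B_def V_def by (intro rat_cong_scale sum_multiples_triples nd) auto
  also have "3 * (- 2 * B + 2 * V) = - 6 * B + 2 * (3 * V)"
    by simp
  also have "rat_cong p 1 \<dots> (- 6 * B + 2 * ((1 - 1 / of_nat q ^ 2) * B))"
    unfolding V_def B_def by (intro rat_cong_add rat_cong_scale voronoi nd rat_cong_refl) auto
  finally have 2: "rat_cong p 1 (3 * A) (- 6 * B + 2 * ((1 - 1 / of_nat q ^ 2) * B))" .
  have "rat_cong p 1 (harmonic_sum (q * p) (p * q)) (of_nat q * (- 2 * B)
      - (- 6 * B + 2 * ((1 - 1 / of_nat q ^ 2) * B)) + 2 * (1 / of_nat q ^ 3) * (- 2 * B))"
    unfolding harmonic_sum_pq_eq[OF q] A_def[symmetric]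
    using harmonic_sum_p q3
    by (intro rat_cong_add rat_cong_diff 1 2 rat_cong_scale pideal_mult0) (auto simp: B_def)
  also have "of_nat q * (- 2 * B) - (- 6 * B + 2 * ((1 - 1 / of_nat q ^ 2) * B))
      + 2 * (1 / of_nat q ^ 3) * (- 2 * B)
    = - 2 * (of_nat q - 2) * (1 - 1 / of_nat q ^ 3) * B"
    using unit_of_nat[OF nd] by (simp add: field_simps power2_eq_square power3_eq_cube)
  finally show ?thesis
    by (simp only: B_def)
qed

section \<open>From \<open>p * q\<close> to arbitrary exponents\<close>

text \<open>Each further factor \<open>p\<close> is a periodicity step with \<open>e = 1\<close>, so
  the modulus grows together with the exponent of \<open>p\<close>. The remaining
  \<open>q ^ b\<close> is then added in a single step with \<open>e = 0\<close>.\<close>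

lemma harmonic_sum_prime_powers:
  assumes q: "prime q" "p \<noteq> q"
  shows "rat_cong p (Suc a) (harmonic_sum (p ^ Suc a * q ^ Suc b) (p * q))
    (of_nat q ^ b * (of_nat p ^ a *
      (- 2 * (of_nat q - 2) * (1 - 1 / of_nat q ^ 3) * bernoulli (p - 3))))"
proof -
  let ?R = "- 2 * (of_nat q - 2) * (1 - 1 / of_nat q ^ 3) * bernoulli (p - 3)"
  have q0: "q > 0"
    using q(1) by (rule prime_gt_0_nat)
  have p_power: "rat_cong p (Suc a) (harmonic_sum (p ^ Suc a * q) (p * q)) (of_nat p ^ a * ?R)"
  proof (induction a)
    case 0
    show ?case
      using harmonic_sum_pq[OF q] by (simp add: mult.commute)
  next
    case (Suc a)
    have "rat_cong p (Suc a + 1) (harmonic_sum (p * (p ^ Suc a * q)) (p * q))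
        (of_nat p * harmonic_sum (p ^ Suc a * q) (p * q))"
      using p_gt_0 q0 by (intro harmonic_sum_period) auto
    also have "rat_cong p (Suc a + 1) \<dots> (of_nat p * (of_nat p ^ a * ?R))"
      using pideal_of_nat[of 1 p] by (intro rat_cong_scale_pideal Suc.IH) auto
    finally show ?case
      by (simp add: mult_ac)
  qed
  have "rat_cong p (Suc a + 0) (harmonic_sum (q ^ b * (p ^ Suc a * q)) (p * q))
      (of_nat (q ^ b) * harmonic_sum (p ^ Suc a * q) (p * q))"
    using p_gt_0 q0 by (intro harmonic_sum_period) auto
  also have "rat_cong p (Suc a + 0) \<dots> (of_nat (q ^ b) * (of_nat p ^ a * ?R))"
    unfolding add_0_right by (rule rat_cong_scale[OF p_power pideal_0_of_nat])
  finally show ?thesis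
    by (simp add: mult_ac)
qed

end

theorem theorem2:
  fixes p q \<alpha> \<beta> :: nat
  assumes "prime p" and "prime q" and "odd p" and "odd q" and "p \<noteq> q"
    and "\<alpha> > 0" and "\<beta> > 0"
  shows "rat_cong p \<alpha>
           (\<Sum>(i, j, k)\<in>sum_triples (p ^ \<alpha> * q ^ \<beta>) (p * q).
              (- 1) ^ i / (of_nat i * of_nat j * of_nat k))
           (- (1 / 4) * Z (p ^ \<alpha> * q ^ \<beta>))
       \<and> rat_cong p \<alpha>
           (- (1 / 4) * Z (p ^ \<alpha> * q ^ \<beta>))
           (1 / 2 * (of_nat q - 2) * (1 - 1 / of_nat q ^ 3)
              * of_nat p ^ (\<alpha> - 1) * of_nat q ^ (\<beta> - 1) * bernoulli (p - 3))"
proof -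
  interpret odd_prime p
    using assms by unfold_locales
  let ?N = "p ^ \<alpha> * q ^ \<beta>"
  \<comment> \<open>Both exponents are positive, so the two moduli have the same prime
    divisors.\<close>
  have "coprime_pos ?N = coprime_pos (p * q)"
    using assms by (auto simp: coprime_pos_def)
  then have Z: "Z ?N = harmonic_sum ?N (p * q)"
    by (simp add: Z_def harmonic_sum_def recip3_def sum_triples_def)
  obtain a b where ab: "\<alpha> = Suc a" "\<beta> = Suc b"
    using assms by (metis Suc_pred')
  have 1: "rat_cong p \<alpha> (\<Sum>(i, j, k)\<in>sum_triples ?N (p * q).
      (- 1) ^ i * recip3 (of_nat i) (of_nat j) (of_nat k)) (- (1 / 4) * harmonic_sum ?N (p * q))"
    using assms by (intro alternating_sum) (auto intro!: mult_dvd_mono)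
  \<comment> \<open>Makes the constant \<open>1 / 4\<close> integral at \<open>p\<close>, so that
    the congruence may be scaled by it.\<close>
  have "\<not> p dvd 4"
    using prime_dvd_power[OF prime_p, of 2 2] dvd_imp_le[of p 2] p_gt_2 by auto
  then have "- (1 / 4) \<in> pideal 0"
    using unit_of_nat[of 4] pideal_minus[of "1 / 4" 0] by simp
  then have 2: "rat_cong p \<alpha> (- (1 / 4) * harmonic_sum ?N (p * q)) (- (1 / 4) *
      (of_nat q ^ b * (of_nat p ^ a *
      (- 2 * (of_nat q - 2) * (1 - 1 / of_nat q ^ 3) * bernoulli (p - 3)))))"
    unfolding ab using harmonic_sum_prime_powers[OF assms(2,5)] by (intro rat_cong_scale)
  have "- (1 / 4) * (of_nat q ^ b * (of_nat p ^ a *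
      (- 2 * (of_nat q - 2) * (1 - 1 / of_nat q ^ 3) * bernoulli (p - 3))))
    = 1 / 2 * (of_nat q - 2) * (1 - 1 / of_nat q ^ 3)
        * of_nat p ^ (\<alpha> - 1) * of_nat q ^ (\<beta> - 1) * bernoulli (p - 3)"
  proof -
    have "- (1 / 4) * (y * (x * (- 2 * w * z * B))) = 1 / 2 * w * z * x * y * B" for w x y z B :: rat
      by simp
    then show ?thesis
      unfolding ab diff_Suc_1 .
  qed
  with 1 2 show ?thesis
    by (simp only: Z recip3_def mult_1_right times_divide_eq_right)
qed

end
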